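(* Let $A$ and $B$ be stable matching instances on the same $n$ workers and $n$ firms in which every worker has the same preference list in $A$ as in $B$. Then a Birkhoff partial order generating the sublattice $\mathcal{M}_A\cap\mathcal{M}_B$ (i.e. a finite poset $\Pi$ whose lattice of closed sets is isomorphic to $\mathcal{M}_A\cap\mathcal{M}_B$ ordered as in $\mathcal{L}_A$) can be computed in time polynomial in $n$, and the matchings in $\mathcal{M}_A\cap\mathcal{M}_B$ can be enumerated efficiently (with polynomial delay).
   Context: In a stable matching instance each agent strictly totally orders the agents of the other side; a perfect matching $M$ is stable under $I$ if no pair $(w,f)\notin M$ has $w$ preferring $f$ to $M(w)$ and $f$ preferring $w$ to $M(f)$ under $I$; $\mathcal{M}_I$ is the set of stable matchings of $I$ and $\mathcal{L}_I$ its lattice, ordered by $M\preceq M'$ iff every worker weakly prefers its $M$-partner to its $M'$-partner, with join (meet) assigning each worker its less (more) preferred partner. In this setting $\mathcal{M}_A\cap\mathcal{M}_B$ is a sublattice of $\mathcal{L}_A$ (closed under its join and meet). A closed set of a poset is a set containing, with every element, all its predecessors; the closed sets form a distributive lattice under union and intersection.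
   Formalization: The intersection of the two sets of stable matchings can be empty, and then no poset generates it, since the empty set is always closed; in that case the algorithm is required to report emptiness instead of a poset. The enumeration claim covers all cases. *)

theory Defs
  imports "HOL-Computational_Algebra.Polynomial"
begin

section \<open>Stable matchings\<close>

text \<open>
  An instance of size \<open>n\<close> has workers \<open>0, \<dots>, n - 1\<close> and firms \<open>0, \<dots>, n - 1\<close>. The strict total
  order of an agent is given by its preference list, most preferred agent first.
\<close>

datatype sm_instance =
  Instance (worker_prefs: "nat list list") (firm_prefs: "nat list list")

definition pref_list :: "nat \<Rightarrow> nat list \<Rightarrow> bool" where
  "pref_list n xs \<longleftrightarrow> distinct xs \<and> set xs = {..<n}"

definition sm_instance :: "nat \<Rightarrow> sm_instance \<Rightarrow> bool" where
  "sm_instance n I \<longleftrightarrow>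
     length (worker_prefs I) = n \<and> (\<forall>xs\<in>set (worker_prefs I). pref_list n xs) \<and>
     length (firm_prefs I) = n \<and> (\<forall>xs\<in>set (firm_prefs I). pref_list n xs)"

definition precedes :: "'a list \<Rightarrow> 'a \<Rightarrow> 'a \<Rightarrow> bool" where
  "precedes xs a b \<longleftrightarrow> (\<exists>i j. i < j \<and> j < length xs \<and> xs ! i = a \<and> xs ! j = b)"

definition worker_prefers :: "sm_instance \<Rightarrow> nat \<Rightarrow> nat \<Rightarrow> nat \<Rightarrow> bool" where
  "worker_prefers I w f f' \<longleftrightarrow> precedes (worker_prefs I ! w) f f'"

definition firm_prefers :: "sm_instance \<Rightarrow> nat \<Rightarrow> nat \<Rightarrow> nat \<Rightarrow> bool" where
  "firm_prefers I f w w' \<longleftrightarrow> precedes (firm_prefs I ! f) w w'"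

text \<open>A matching is a set of (worker, firm) pairs.\<close>

type_synonym matching = "(nat \<times> nat) set"

definition perfect_matching :: "nat \<Rightarrow> matching \<Rightarrow> bool" where
  "perfect_matching n M \<longleftrightarrow>
     M \<subseteq> {..<n} \<times> {..<n} \<and>
     (\<forall>w<n. \<exists>!f. (w, f) \<in> M) \<and> (\<forall>f<n. \<exists>!w. (w, f) \<in> M)"

definition firm_of :: "matching \<Rightarrow> nat \<Rightarrow> nat" where
  "firm_of M w = (THE f. (w, f) \<in> M)"

definition worker_of :: "matching \<Rightarrow> nat \<Rightarrow> nat" where
  "worker_of M f = (THE w. (w, f) \<in> M)"

definition stable :: "nat \<Rightarrow> sm_instance \<Rightarrow> matching \<Rightarrow> bool" where
  "stable n I M \<longleftrightarrow> perfect_matching n M \<and>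
     \<not> (\<exists>w<n. \<exists>f<n. (w, f) \<notin> M \<and>
          worker_prefers I w f (firm_of M w) \<and> firm_prefers I f w (worker_of M f))"

definition stable_matchings :: "nat \<Rightarrow> sm_instance \<Rightarrow> matching set" where
  "stable_matchings n I = {M. stable n I M}"

definition matching_le :: "nat \<Rightarrow> sm_instance \<Rightarrow> matching \<Rightarrow> matching \<Rightarrow> bool" where
  "matching_le n I M M' \<longleftrightarrow>
     (\<forall>w<n. firm_of M w = firm_of M' w \<or> worker_prefers I w (firm_of M w) (firm_of M' w))"

definition matching_join :: "nat \<Rightarrow> sm_instance \<Rightarrow> matching \<Rightarrow> matching \<Rightarrow> matching" where
  "matching_join n I M M' =
     {(w, if worker_prefers I w (firm_of M w) (firm_of M' w) then firm_of M' w else firm_of M w)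
      | w. w < n}"

definition matching_meet :: "nat \<Rightarrow> sm_instance \<Rightarrow> matching \<Rightarrow> matching \<Rightarrow> matching" where
  "matching_meet n I M M' =
     {(w, if worker_prefers I w (firm_of M w) (firm_of M' w) then firm_of M w else firm_of M' w)
      | w. w < n}"


section \<open>Birkhoff partial orders\<close>

text \<open>A pair \<open>(x, y)\<close> in the relation \<open>R\<close> means that \<open>x\<close> is below \<open>y\<close>.\<close>

definition closed_sets :: "'a set \<Rightarrow> 'a rel \<Rightarrow> 'a set set" where
  "closed_sets C R = {X. X \<subseteq> C \<and> (\<forall>x\<in>X. \<forall>y. (y, x) \<in> R \<longrightarrow> y \<in> X)}"

definition birkhoff_order ::
  "nat \<Rightarrow> sm_instance \<Rightarrow> matching set \<Rightarrow> 'a set \<Rightarrow> 'a rel \<Rightarrow> bool" where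
  "birkhoff_order n I S C R \<longleftrightarrow>
     finite C \<and> partial_order_on C R \<and>
     (\<exists>\<phi>. bij_betw \<phi> (closed_sets C R) S \<and>
        (\<forall>X\<in>closed_sets C R. \<forall>Y\<in>closed_sets C R.
           (X \<subseteq> Y \<longleftrightarrow> matching_le n I (\<phi> X) (\<phi> Y)) \<and>
           \<phi> (X \<union> Y) = matching_join n I (\<phi> X) (\<phi> Y) \<and>
           \<phi> (X \<inter> Y) = matching_meet n I (\<phi> X) (\<phi> Y)))"


section \<open>Model of computation\<close>

text \<open>
  Programs of a first-order call-by-value language over binary trees (S-expressions), in the style
  of Jones, ``Computability and Complexity from a Programming Perspective''. Values are immutable,
  so an implementation passes references, and for a fixed program every step below manipulates
  boundedly many of them. Running time in this model is therefore polynomially related to running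
  time on Turing machines, provided that a result, which may share subtrees, is charged by its
  size as a tree. This is done in \<open>ex_Emit\<close> and in \<open>run_time\<close>.
\<close>

datatype sexp = Leaf | Node sexp sexp

text \<open>Variables are de Bruijn indices; a program is the list of the bodies of its functions.\<close>

datatype expr =
    EVar nat
  | ELeaf
  | ENode expr expr
  | EFst expr
  | ESnd expr
  | EIf expr expr expr
  | ELet expr expr
  | ECall nat "expr list"
  | EEmit expr

type_synonym program = "expr list"

text \<open>An execution trace records the time steps and the outputs in chronological order.\<close>

datatype event = Step | Out sexp

primrec sexp_fst :: "sexp \<Rightarrow> sexp" where
  "sexp_fst Leaf = Leaf"
| "sexp_fst (Node a b) = a"

primrec sexp_snd :: "sexp \<Rightarrow> sexp" where
  "sexp_snd Leaf = Leaf"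
| "sexp_snd (Node a b) = b"

inductive exec :: "program \<Rightarrow> sexp list \<Rightarrow> expr \<Rightarrow> event list \<Rightarrow> sexp \<Rightarrow> bool"
  and execs :: "program \<Rightarrow> sexp list \<Rightarrow> expr list \<Rightarrow> event list \<Rightarrow> sexp list \<Rightarrow> bool"
  for P :: program
where
  ex_Var: "i < length env \<Longrightarrow> exec P env (EVar i) [Step] (env ! i)"
| ex_Leaf: "exec P env ELeaf [Step] Leaf"
| ex_Node: "exec P env e1 t1 v1 \<Longrightarrow> exec P env e2 t2 v2 \<Longrightarrow>
    exec P env (ENode e1 e2) (t1 @ t2 @ [Step]) (Node v1 v2)"
| ex_Fst: "exec P env e t v \<Longrightarrow> exec P env (EFst e) (t @ [Step]) (sexp_fst v)"
| ex_Snd: "exec P env e t v \<Longrightarrow> exec P env (ESnd e) (t @ [Step]) (sexp_snd v)"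
| ex_If_true: "exec P env e t v \<Longrightarrow> v \<noteq> Leaf \<Longrightarrow> exec P env e1 t1 v1 \<Longrightarrow>
    exec P env (EIf e e1 e2) (t @ [Step] @ t1) v1"
| ex_If_false: "exec P env e t v \<Longrightarrow> v = Leaf \<Longrightarrow> exec P env e2 t2 v2 \<Longrightarrow>
    exec P env (EIf e e1 e2) (t @ [Step] @ t2) v2"
| ex_Let: "exec P env e1 t1 v1 \<Longrightarrow> exec P (v1 # env) e2 t2 v2 \<Longrightarrow>
    exec P env (ELet e1 e2) (t1 @ [Step] @ t2) v2"
| ex_Call: "execs P env es t vs \<Longrightarrow> f < length P \<Longrightarrow> exec P vs (P ! f) t' v \<Longrightarrow>
    exec P env (ECall f es) (t @ [Step] @ t') v"
| ex_Emit: "exec P env e t v \<Longrightarrow>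
    exec P env (EEmit e) (t @ replicate (size v + 1) Step @ [Out v]) v"
| exs_Nil: "execs P env [] [] []"
| exs_Cons: "exec P env e t v \<Longrightarrow> execs P env es t' vs \<Longrightarrow>
    execs P env (e # es) (t @ t') (v # vs)"

text \<open>Function 0 is the main function; it receives the input as its only argument.\<close>

definition run :: "program \<Rightarrow> sexp \<Rightarrow> event list \<Rightarrow> sexp \<Rightarrow> bool" where
  "run P x t v \<longleftrightarrow> exec P [x] (ECall 0 [EVar 0]) t v"

definition run_time :: "event list \<Rightarrow> sexp \<Rightarrow> nat" where
  "run_time t v = length t + size v"

lemma exec_deterministic:
  "exec P env e t v \<Longrightarrow> exec P env e t' v' \<Longrightarrow> t' = t \<and> v' = v"
  "execs P env es ts vs \<Longrightarrow> execs P env es ts' vs' \<Longrightarrow> ts' = ts \<and> vs' = vs"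
proof (induction arbitrary: t' v' and ts' vs' rule: exec_execs.inducts)
  case (ex_Var i env) from ex_Var.prems show ?case by cases simp
next
  case (ex_Leaf env) from ex_Leaf.prems show ?case by cases simp
next
  case ex_Node from ex_Node.prems show ?case by cases (use ex_Node.IH in blast)
next
  case ex_Fst from ex_Fst.prems show ?case by cases (use ex_Fst.IH in blast)
next
  case ex_Snd from ex_Snd.prems show ?case by cases (use ex_Snd.IH in blast)
next
  case ex_If_true
  from ex_If_true.prems show ?case by cases (use ex_If_true.IH ex_If_true.hyps in blast)+
next
  case ex_If_false
  from ex_If_false.prems show ?case by cases (use ex_If_false.IH ex_If_false.hyps in blast)+
next
  case ex_Let from ex_Let.prems show ?case by cases (use ex_Let.IH in blast)
next
  case ex_Call from ex_Call.prems show ?case by cases (use ex_Call.IH in blast)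
next
  case ex_Emit from ex_Emit.prems show ?case by cases (use ex_Emit.IH in blast)
next
  case exs_Nil from exs_Nil.prems show ?case by cases simp
next
  case exs_Cons from exs_Cons.prems show ?case by cases (use exs_Cons.IH in blast)
qed

fun outputs :: "event list \<Rightarrow> sexp list" where
  "outputs [] = []"
| "outputs (Step # t) = outputs t"
| "outputs (Out v # t) = v # outputs t"

text \<open>
  The delay bound covers the time before the first output, between consecutive outputs, and after
  the last output until termination.
\<close>

definition delay_at_most :: "nat \<Rightarrow> event list \<Rightarrow> bool" where
  "delay_at_most d t \<longleftrightarrow>
     (\<forall>xs ys zs. t = xs @ ys @ zs \<and> set ys \<subseteq> {Step} \<longrightarrow> length ys \<le> d)"


section \<open>Encodings\<close>

text \<open>
  Numbers are encoded in unary. All numbers that occur are polynomially bounded in \<open>n\<close>, so the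
  encoding of an instance has size polynomial in \<open>n\<close>.
\<close>

primrec enc_nat :: "nat \<Rightarrow> sexp" where
  "enc_nat 0 = Leaf"
| "enc_nat (Suc k) = Node Leaf (enc_nat k)"

primrec enc_list :: "('a \<Rightarrow> sexp) \<Rightarrow> 'a list \<Rightarrow> sexp" where
  "enc_list enc [] = Leaf"
| "enc_list enc (x # xs) = Node (enc x) (enc_list enc xs)"

definition enc_pair :: "('a \<Rightarrow> sexp) \<Rightarrow> ('b \<Rightarrow> sexp) \<Rightarrow> 'a \<times> 'b \<Rightarrow> sexp" where
  "enc_pair enc1 enc2 p = Node (enc1 (fst p)) (enc2 (snd p))"

definition enc_instance :: "sm_instance \<Rightarrow> sexp" where
  "enc_instance I =
     Node (enc_list (enc_list enc_nat) (worker_prefs I)) (enc_list (enc_list enc_nat) (firm_prefs I))"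

definition enc_input :: "sm_instance \<Rightarrow> sm_instance \<Rightarrow> sexp" where
  "enc_input A B = Node (enc_instance A) (enc_instance B)"

definition enc_matching :: "nat \<Rightarrow> matching \<Rightarrow> sexp" where
  "enc_matching n M = enc_list enc_nat (map (firm_of M) [0..<n])"

text \<open>
  A finite poset with \<open>m\<close> elements is presented on the carrier \<open>{..<m}\<close>, with its order relation as
  a list of pairs.
\<close>

definition enc_poset :: "nat \<Rightarrow> (nat \<times> nat) list \<Rightarrow> sexp" where
  "enc_poset m rs = Node (enc_nat m) (enc_list (enc_pair enc_nat enc_nat) rs)"

text \<open>
  The lattice of closed sets of a poset is never empty, so an empty \<open>S\<close> has no Birkhoff partial
  order; the answer \<open>Leaf\<close>, which encodes no poset, reports exactly this case.
\<close>

definition birkhoff_answer ::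
  "nat \<Rightarrow> sm_instance \<Rightarrow> matching set \<Rightarrow> sexp \<Rightarrow> bool" where
  "birkhoff_answer n I S v \<longleftrightarrow>
     (if S = {} then v = Leaf
      else \<exists>m rs. v = enc_poset m rs \<and> birkhoff_order n I S {..<m} (set rs))"

end

theory Submission
  imports Defs
begin

text \<open>
  Represent a matching by the vector \<open>p\<close> of the positions of the assigned firms in the lists of
  the workers. A worker \<open>w\<close> is forbidden in \<open>p\<close> if some worker \<open>v\<close> likes the firm assigned to \<open>w\<close>
  at least as much as the firm assigned to \<open>v\<close> while that firm prefers \<open>v\<close> to \<open>w\<close> in \<open>A\<close> or in \<open>B\<close>. The
  common stable matchings are exactly the vectors without forbidden workers (the feasible ones),
  and a forbidden worker of \<open>p\<close> must advance in every feasible vector above \<open>p\<close>. Advancing all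
  forbidden workers repeatedly therefore yields, after at most \<open>n\<^sup>2\<close> rounds, the least feasible vector
  above \<open>p\<close>, or shows that there is none.

  The least feasible vectors \<open>g\<close> with \<open>g ! w \<ge> k\<close> are join-prime, and every feasible vector is a join of
  such vectors. Their at most \<open>n\<^sup>2\<close> many values other than the bottom element, ordered
  componentwise, thus form a Birkhoff order. For the enumeration, the lexicographic successor of a
  feasible vector \<open>p\<close> is found by \<open>n\<close> least-vector computations: for \<open>w = n - 1, \<dots>, 0\<close>, keep
  the entries of \<open>p\<close> before \<open>w\<close>, raise the entry at \<open>w\<close> by one and reset the later ones to \<open>0\<close>.
\<close>

section \<open>The lattice of common stable matchings\<close>

text \<open>Because the worker lists coincide, blocking pairs of \<open>A\<close> and of
  \<open>B\<close> differ only in the condition on the firm, so one notion of forbidden worker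
  serves both instances. The union \<open>prefers_either\<close> of two linear orders need not be
  transitive, however, so the lattice argument for a single instance does not carry over to it
  directly. Minima are unaffected: they rest only on the fact that advancing other workers keeps a
  forbidden worker forbidden. Maxima need transitivity and are treated with one of the two instances
  fixed, after a counting argument. Freedom from forbidden workers also rules out two workers at one
  firm, so feasible vectors are perfect matchings automatically. The successor search works because
  a least feasible vector decides whether a prefix can be kept: if some feasible vector above the
  bound keeps it, the least one is squeezed into keeping it too. The programs do no arithmetic on
  positions. They hold the position of a worker as the rest of the preference list, so that
  advancing means taking the tail.\<close>

lemma pref_list_length: "pref_list n xs \<Longrightarrow> length xs = n"
  by (metis card_lessThan distinct_card pref_list_def)

lemma precedes_nth_iff:
  "distinct xs \<Longrightarrow> i < length xs \<Longrightarrow> j < length xs \<Longrightarrow> precedes xs (xs ! i) (xs ! j) \<longleftrightarrow> i < j"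
  by (auto simp: precedes_def nth_eq_iff_index_eq)

lemma precedes_irrefl: "distinct xs \<Longrightarrow> \<not> precedes xs a a"
  by (auto simp: precedes_def nth_eq_iff_index_eq)

lemma precedes_trans:
  "distinct xs \<Longrightarrow> precedes xs a b \<Longrightarrow> precedes xs b c \<Longrightarrow> precedes xs a c"
  unfolding precedes_def
  by (metis (no_types, lifting) less_trans nth_eq_iff_index_eq)

lemma precedes_linear:
  "a \<in> set xs \<Longrightarrow> b \<in> set xs \<Longrightarrow> a \<noteq> b \<Longrightarrow> precedes xs a b \<or> precedes xs b a"
  unfolding precedes_def by (metis in_set_conv_nth linorder_neqE_nat)

lemma set_drop_conv: "set (drop k xs) = {xs ! i | i. k \<le> i \<and> i < length xs}"
proof -
  have "\<exists>j. xs ! i = xs ! (k + j) \<and> j < length xs - k" if "k \<le> i" "i < length xs" for i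
    using that by (intro exI[of _ "i - k"]) simp
  then show ?thesis
    by (force simp: in_set_conv_nth)
qed

section \<open>Position vectors under the componentwise and the lexicographic order\<close>

abbreviation vec_le :: "nat list \<Rightarrow> nat list \<Rightarrow> bool" (infix "\<sqsubseteq>" 50) where
  "p \<sqsubseteq> q \<equiv> list_all2 (\<le>) p q"

abbreviation vec_max :: "nat list \<Rightarrow> nat list \<Rightarrow> nat list" where
  "vec_max \<equiv> map2 max"

abbreviation vec_min :: "nat list \<Rightarrow> nat list \<Rightarrow> nat list" where
  "vec_min \<equiv> map2 min"

lemma vec_le_antisym: "p \<sqsubseteq> q \<Longrightarrow> q \<sqsubseteq> p \<Longrightarrow> p = q"
  by (auto simp: list_all2_conv_all_nth intro!: nth_equalityI antisym)

lemma vec_le_trans: "p \<sqsubseteq> q \<Longrightarrow> q \<sqsubseteq> r \<Longrightarrow> p \<sqsubseteq> r"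
  by (rule list_all2_trans[OF le_trans])

text \<open>At the first entry where comparable vectors differ, the smaller vector has the smaller
  entry. This turns least feasible vectors into lexicographically first ones in the
  enumeration.\<close>

lemma vec_le_imp_lexord: "p \<sqsubseteq> q \<Longrightarrow> p \<noteq> q \<Longrightarrow> (p, q) \<in> lexord {(x, y). x < y}"
  by (induction rule: list_all2_induct) (auto simp: le_less)

lemma lexord_equal_length_iff:
  "length p = n \<Longrightarrow> length q = n \<Longrightarrow>
   (p, q) \<in> lexord {(x, y). x < y} \<longleftrightarrow> (\<exists>i<n. take i p = take i q \<and> p ! i < (q ! i :: nat))"
  by (auto simp: lexord_take_index_conv)

section \<open>Feasible vectors and common stable matchings\<close>

locale common_instances =
  fixes n :: nat and A B :: sm_instance
  assumes inst_A: "sm_instance n A" and inst_B: "sm_instance n B"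
    and same_prefs: "worker_prefs A = worker_prefs B"
begin

abbreviation W :: "nat list list" where
  "W \<equiv> worker_prefs A"

definition assigned :: "nat list \<Rightarrow> nat \<Rightarrow> nat" where
  "assigned p w = W ! w ! (p ! w)"

definition prefers_either :: "nat \<Rightarrow> nat \<Rightarrow> nat \<Rightarrow> bool" where
  "prefers_either f v w \<longleftrightarrow> firm_prefers A f v w \<or> firm_prefers B f v w"

text \<open>Liking a firm at least as much is phrased as its absence from the list after position
  \<open>p ! v\<close>. This still makes sense for the overflow position \<open>n\<close>, is
  monotone in \<open>p ! v\<close>, and is the test that the program performs on list tails.\<close>

definition forbidden :: "nat list \<Rightarrow> nat \<Rightarrow> bool" where
  "forbidden p w \<longleftrightarrow>
     (\<exists>v<n. assigned p w \<notin> set (drop (Suc (p ! v)) (W ! v)) \<and> prefers_either (assigned p w) v w)"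

definition feasible :: "nat list set" where
  "feasible = {p. length p = n \<and> (\<forall>w<n. p ! w < n \<and> \<not> forbidden p w)}"

definition matching_at :: "nat list \<Rightarrow> matching" where
  "matching_at p = {(w, assigned p w) | w. w < n}"

lemma W_props:
  "length W = n"
  "w < n \<Longrightarrow> length (W ! w) = n"
  "w < n \<Longrightarrow> distinct (W ! w)"
  "w < n \<Longrightarrow> set (W ! w) = {..<n}"
proof -
  show "length W = n"
    using inst_A by (simp add: sm_instance_def)
  assume "w < n"
  with inst_A have "pref_list n (W ! w)"
    by (simp add: sm_instance_def)
  then show "length (W ! w) = n" "distinct (W ! w)" "set (W ! w) = {..<n}"
    by (simp_all add: pref_list_def pref_list_length)
qed

lemma W_nth_less: "w < n \<Longrightarrow> i < n \<Longrightarrow> W ! w ! i < n"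
  using W_props(2-4)[of w] nth_mem[of i "W ! w"] by simp

lemma W_nth_eq_iff: "w < n \<Longrightarrow> i < n \<Longrightarrow> j < n \<Longrightarrow> W ! w ! i = W ! w ! j \<longleftrightarrow> i = j"
  using W_props(2-4)[of w] by (simp add: nth_eq_iff_index_eq)

lemma W_nth_surj: "w < n \<Longrightarrow> f < n \<Longrightarrow> \<exists>i<n. W ! w ! i = f"
  using W_props(2,4)[of w] by (metis in_set_conv_nth lessThan_iff)

lemma nth_in_drop_iff: "w < n \<Longrightarrow> i < n \<Longrightarrow> W ! w ! i \<in> set (drop k (W ! w)) \<longleftrightarrow> k \<le> i"
  using W_props(2,3)[of w]
  by (auto simp: set_drop_conv nth_eq_iff_index_eq)

lemma nth_in_drop_Suc_iff:
  "w < n \<Longrightarrow> i < n \<Longrightarrow> W ! w ! i \<in> set (drop (Suc k) (W ! w)) \<longleftrightarrow> k < i"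
  by (simp add: nth_in_drop_iff Suc_le_eq)

lemma firm_list_props:
  assumes "I \<in> {A, B}"
  shows "length (firm_prefs I) = n"
    "f < n \<Longrightarrow> length (firm_prefs I ! f) = n"
    "f < n \<Longrightarrow> distinct (firm_prefs I ! f)"
    "f < n \<Longrightarrow> set (firm_prefs I ! f) = {..<n}"
proof -
  have I: "sm_instance n I"
    using assms inst_A inst_B by auto
  then show "length (firm_prefs I) = n"
    by (simp add: sm_instance_def)
  assume "f < n"
  with I have "pref_list n (firm_prefs I ! f)"
    by (simp add: sm_instance_def)
  then show "length (firm_prefs I ! f) = n" "distinct (firm_prefs I ! f)"
    "set (firm_prefs I ! f) = {..<n}"
    by (simp_all add: pref_list_def pref_list_length)
qed

lemma firm_prefers_irrefl: "I \<in> {A, B} \<Longrightarrow> f < n \<Longrightarrow> \<not> firm_prefers I f w w"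
  using firm_list_props(2-4)[of I f] by (simp add: firm_prefers_def precedes_irrefl)

lemma firm_prefers_trans:
  "I \<in> {A, B} \<Longrightarrow> f < n \<Longrightarrow> firm_prefers I f u v \<Longrightarrow> firm_prefers I f v w \<Longrightarrow> firm_prefers I f u w"
  using firm_list_props(2-4)[of I f] unfolding firm_prefers_def by (blast intro: precedes_trans)

lemma firm_prefers_linear:
  "I \<in> {A, B} \<Longrightarrow> f < n \<Longrightarrow> v < n \<Longrightarrow> w < n \<Longrightarrow> v \<noteq> w \<Longrightarrow>
   firm_prefers I f v w \<or> firm_prefers I f w v"
  using firm_list_props(2-4)[of I f] unfolding firm_prefers_def by (metis lessThan_iff precedes_linear)

lemma prefers_eitherI: "I \<in> {A, B} \<Longrightarrow> firm_prefers I f v w \<Longrightarrow> prefers_either f v w"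
  by (auto simp: prefers_either_def)

lemma forbiddenI:
  "v < n \<Longrightarrow> assigned p w \<notin> set (drop (Suc (p ! v)) (W ! v)) \<Longrightarrow>
   prefers_either (assigned p w) v w \<Longrightarrow> forbidden p w"
  by (auto simp: forbidden_def)

lemma feasibleD:
  assumes "p \<in> feasible"
  shows "length p = n" "w < n \<Longrightarrow> p ! w < n" "w < n \<Longrightarrow> \<not> forbidden p w"
    "w < n \<Longrightarrow> assigned p w < n"
  using assms W_nth_less by (auto simp: feasible_def assigned_def)

lemma assigned_notin_drop: "w < n \<Longrightarrow> p ! w < n \<Longrightarrow> assigned p w \<notin> set (drop (Suc (p ! w)) (W ! w))"
  by (simp add: assigned_def nth_in_drop_Suc_iff)

text \<open>A firm held by two workers prefers one of them in \<open>A\<close>. That worker likes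
  the firm as much as its own assignment, which is the same firm, and therefore forbids the other
  one.\<close>

lemma assigned_inj:
  assumes "p \<in> feasible"
  shows "inj_on (assigned p) {..<n}"
proof (rule inj_onI, rule ccontr)
  fix v w
  assume *: "v \<in> {..<n}" "w \<in> {..<n}" "assigned p v = assigned p w" "v \<noteq> w"
  then have "firm_prefers A (assigned p v) v w \<or> firm_prefers A (assigned p v) w v"
    using firm_prefers_linear[of A] feasibleD[OF assms] by auto
  then have "forbidden p v \<or> forbidden p w"
    using * assigned_notin_drop[of _ p] feasibleD[OF assms] prefers_eitherI[of A]
    by (metis forbiddenI insertI1 lessThan_iff)
  with * feasibleD[OF assms] show False
    by auto
qed

lemma assigned_bij:
  assumes "p \<in> feasible"
  shows "bij_betw (assigned p) {..<n} {..<n}"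
proof -
  have "assigned p ` {..<n} \<subseteq> {..<n}"
    using feasibleD[OF assms] by auto
  then show ?thesis
    using assigned_inj[OF assms] by (simp add: bij_betw_def endo_inj_surj)
qed

lemma assigned_surj:
  assumes "p \<in> feasible" "f < n"
  obtains w where "w < n" "assigned p w = f"
  using assms assigned_bij[OF assms(1)] by (metis bij_betw_def imageE lessThan_iff)

lemma firm_of_matching_at: "w < n \<Longrightarrow> firm_of (matching_at p) w = assigned p w"
  by (auto simp: firm_of_def matching_at_def)

lemma worker_of_matching_at:
  assumes "p \<in> feasible" "w < n"
  shows "worker_of (matching_at p) (assigned p w) = w"
  unfolding worker_of_def matching_at_def
proof (rule the_equality)
  show "v = w" if "(v, assigned p w) \<in> {(w, assigned p w) |w. w < n}" for v
    using that assigned_inj[OF assms(1)] assms(2) by (auto dest: inj_onD)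
qed (use assms in auto)

lemma perfect_matching_at:
  assumes "p \<in> feasible"
  shows "perfect_matching n (matching_at p)"
  unfolding perfect_matching_def
proof (intro conjI allI impI)
  show "matching_at p \<subseteq> {..<n} \<times> {..<n}"
    using feasibleD[OF assms] by (auto simp: matching_at_def)
  show "\<exists>!f. (w, f) \<in> matching_at p" if "w < n" for w
    using that by (auto simp: matching_at_def)
  show "\<exists>!w. (w, f) \<in> matching_at p" if f: "f < n" for f
  proof -
    obtain w where w: "w < n" "assigned p w = f"
      using assigned_surj[OF assms f] .
    then show ?thesis
      using assigned_inj[OF assms] by (intro ex1I[of _ w]) (auto simp: matching_at_def dest: inj_onD)
  qed
qed

lemma worker_prefers_iff:
  "I \<in> {A, B} \<Longrightarrow> w < n \<Longrightarrow> i < n \<Longrightarrow> j < n \<Longrightarrow>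
   worker_prefers I w (W ! w ! i) (W ! w ! j) \<longleftrightarrow> i < j"
  by (auto simp: worker_prefers_def same_prefs[symmetric] precedes_nth_iff W_props)

text \<open>If \<open>(w, f)\<close> blocks, then \<open>w\<close> is a witness that the worker
  holding \<open>f\<close> is forbidden.\<close>

lemma stable_matching_at:
  assumes p: "p \<in> feasible" and I: "I \<in> {A, B}"
  shows "stable n I (matching_at p)"
  unfolding stable_def
proof (intro conjI notI)
  show "perfect_matching n (matching_at p)"
    by (rule perfect_matching_at[OF p])
  assume "\<exists>w<n. \<exists>f<n. (w, f) \<notin> matching_at p \<and>
    worker_prefers I w f (firm_of (matching_at p) w) \<and>
    firm_prefers I f w (worker_of (matching_at p) f)"
  then obtain w f where wf: "w < n" "f < n"
    "worker_prefers I w f (firm_of (matching_at p) w)"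
    "firm_prefers I f w (worker_of (matching_at p) f)" by blast
  obtain v where v: "v < n" "assigned p v = f"
    using assigned_surj[OF p wf(2)] .
  obtain i where i: "i < n" "W ! w ! i = f"
    using W_nth_surj[OF wf(1,2)] by blast
  have "i < p ! w"
    using wf(3) i worker_prefers_iff[OF I wf(1) i(1), of "p ! w"] feasibleD[OF p] wf(1)
    by (simp add: firm_of_matching_at assigned_def)
  then have "f \<notin> set (drop (Suc (p ! w)) (W ! w))"
    using nth_in_drop_Suc_iff[OF wf(1) i(1)] i(2) by auto
  moreover have "prefers_either f w v"
    using wf(4) worker_of_matching_at[OF p v(1)] v(2) I by (auto intro: prefers_eitherI)
  ultimately have "forbidden p v"
    using v(2) wf(1) by (auto intro: forbiddenI)
  with v feasibleD[OF p] show False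
    by blast
qed

lemma firm_of_mem: "perfect_matching n M \<Longrightarrow> w < n \<Longrightarrow> (w, firm_of M w) \<in> M"
  unfolding perfect_matching_def firm_of_def by (metis (no_types, lifting) theI')

lemma firm_of_eq:
  assumes "perfect_matching n M" "(w, f) \<in> M"
  shows "firm_of M w = f"
proof -
  have "\<exists>!f. (w, f) \<in> M"
    using assms by (auto simp: perfect_matching_def)
  then show ?thesis
    using assms(2) unfolding firm_of_def by (rule the1_equality)
qed

lemma worker_of_eq:
  assumes "perfect_matching n M" "(w, f) \<in> M"
  shows "worker_of M f = w"
proof -
  have "\<exists>!w. (w, f) \<in> M"
    using assms by (auto simp: perfect_matching_def)
  then show ?thesis
    using assms(2) unfolding worker_of_def by (rule the1_equality)
qed

text \<open>A witness \<open>v\<close> for a forbidden \<open>w\<close> blocks together with the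
  firm of \<open>w\<close>, in whichever of the two instances that firm prefers \<open>v\<close>.
  Hence stability in both instances is used.\<close>

lemma common_stable_matching_at:
  assumes MA: "stable n A M" and MB: "stable n B M"
  shows "\<exists>p\<in>feasible. M = matching_at p"
proof -
  have M: "perfect_matching n M"
    using MA by (simp add: stable_def)
  have less: "firm_of M w < n" if "w < n" for w
    using firm_of_mem[OF M that] M by (auto simp: perfect_matching_def)
  define p where "p = map (\<lambda>w. SOME i. i < n \<and> W ! w ! i = firm_of M w) [0..<n]"
  have len: "length p = n"
    by (simp add: p_def)
  have p: "p ! w < n" "assigned p w = firm_of M w" if "w < n" for w
    using someI_ex[OF W_nth_surj[OF that less[OF that], unfolded Bex_def]] that
    by (auto simp: p_def assigned_def)
  have "M = matching_at p"
  proof (rule set_eqI)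
    fix x
    show "x \<in> M \<longleftrightarrow> x \<in> matching_at p"
    proof (cases x)
      case (Pair w f)
      show ?thesis
        using M p(2) firm_of_mem[OF M] firm_of_eq[OF M]
        by (auto simp: Pair matching_at_def perfect_matching_def)
    qed
  qed
  moreover have "\<not> forbidden p w" if w: "w < n" for w
  proof
    assume "forbidden p w"
    then obtain v I where v: "v < n" "assigned p w \<notin> set (drop (Suc (p ! v)) (W ! v))"
      and I: "I \<in> {A, B}" "firm_prefers I (assigned p w) v w"
      by (auto simp: forbidden_def prefers_either_def)
    obtain i where i: "i < n" "W ! v ! i = assigned p w"
      using W_nth_surj[OF v(1)] less p(2) w by metis
    have mem: "(w, assigned p w) \<in> M" "(v, assigned p v) \<in> M"
      using w v p(2) firm_of_mem[OF M] by auto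
    have "v \<noteq> w"
      using I less[OF w] p(2)[OF w] firm_prefers_irrefl by auto
    then have not_M: "(v, assigned p w) \<notin> M"
      using worker_of_eq[OF M mem(1)] worker_of_eq[OF M] by blast
    have "i \<le> p ! v"
      using v i nth_in_drop_Suc_iff by (metis not_le)
    \<comment> \<open>The weak comparison in \<open>forbidden\<close> becomes the strict one of a
      blocking pair: \<open>v\<close> cannot hold the firm, as \<open>M\<close> gives it to
      \<open>w\<close> alone.\<close>
    moreover have "i \<noteq> p ! v"
      using i(2) mem(2) not_M by (auto simp: assigned_def)
    ultimately have "worker_prefers I v (assigned p w) (firm_of M v)"
      using worker_prefers_iff[OF I(1) v(1) i(1) p(1)[OF v(1)]] p(2)[OF v(1)] i(2)
      by (simp add: assigned_def)
    moreover have "stable n I M"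
      using I MA MB by auto
    ultimately show False
      using not_M v(1) less[OF w] p(2)[OF w] I(2) worker_of_eq[OF M mem(1)]
      unfolding stable_def by metis
  qed
  ultimately show ?thesis
    using len p by (auto simp: feasible_def)
qed

lemma matching_at_inj: "inj_on matching_at feasible"
proof (rule inj_onI)
  fix p q
  assume p: "p \<in> feasible" and q: "q \<in> feasible" and eq: "matching_at p = matching_at q"
  have "p ! w = q ! w" if "w < n" for w
    using firm_of_matching_at[OF that, of p] firm_of_matching_at[OF that, of q] eq
      W_nth_eq_iff[OF that] feasibleD[OF p] feasibleD[OF q] that by (simp add: assigned_def)
  then show "p = q"
    using feasibleD[OF p] feasibleD[OF q] by (auto intro: nth_equalityI)
qed

lemma matching_at_bij:
  "bij_betw matching_at feasible (stable_matchings n A \<inter> stable_matchings n B)"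
  using matching_at_inj common_stable_matching_at stable_matching_at
  by (auto simp: bij_betw_def stable_matchings_def)

lemma matching_le_iff:
  assumes "p \<in> feasible" "q \<in> feasible"
  shows "matching_le n A (matching_at p) (matching_at q) \<longleftrightarrow> p \<sqsubseteq> q"
  using feasibleD[OF assms(1)] feasibleD[OF assms(2)] worker_prefers_iff[of A] W_nth_eq_iff
  by (auto simp: matching_le_def firm_of_matching_at assigned_def list_all2_conv_all_nth
    intro: le_neq_implies_less less_imp_le)

lemma matching_join_at:
  assumes "p \<in> feasible" "q \<in> feasible"
  shows "matching_join n A (matching_at p) (matching_at q) = matching_at (vec_max p q)"
proof -
  have *: "(if worker_prefers A w (firm_of (matching_at p) w) (firm_of (matching_at q) w)
      then firm_of (matching_at q) w else firm_of (matching_at p) w)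
    = assigned (vec_max p q) w" if "w < n" for w
    using that feasibleD[OF assms(1)] feasibleD[OF assms(2)] worker_prefers_iff[of A]
    by (auto simp: firm_of_matching_at assigned_def max_def)
  show ?thesis
    unfolding matching_join_def matching_at_def[of "vec_max p q"]
    by (intro Collect_cong ex_cong1 rev_conj_cong refl) (simp only: *)
qed

lemma matching_meet_at:
  assumes "p \<in> feasible" "q \<in> feasible"
  shows "matching_meet n A (matching_at p) (matching_at q) = matching_at (vec_min p q)"
proof -
  have *: "(if worker_prefers A w (firm_of (matching_at p) w) (firm_of (matching_at q) w)
      then firm_of (matching_at p) w else firm_of (matching_at q) w)
    = assigned (vec_min p q) w" if "w < n" for w
    using that feasibleD[OF assms(1)] feasibleD[OF assms(2)] worker_prefers_iff[of A]
    by (auto simp: firm_of_matching_at assigned_def min_def)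
  show ?thesis
    unfolding matching_meet_def matching_at_def[of "vec_min p q"]
    by (intro Collect_cong ex_cong1 rev_conj_cong refl) (simp only: *)
qed


section \<open>Least feasible vectors above a given vector\<close>

lemma forbidden_mono:
  assumes "p \<sqsubseteq> q" "length p = n" "p ! w = q ! w" "forbidden p w"
  shows "forbidden q w"
proof -
  obtain v where v: "v < n" "assigned p w \<notin> set (drop (Suc (p ! v)) (W ! v))"
    "prefers_either (assigned p w) v w"
    using assms(4) by (auto simp: forbidden_def)
  \<comment> \<open>The witness \<open>v\<close> survives: moving \<open>v\<close> down its list
    only enlarges the set of firms that it likes at least as much as its own.\<close>
  have "Suc (p ! v) \<le> Suc (q ! v)"
    using assms(1,2) v(1) by (simp add: list_all2_conv_all_nth)
  then have "set (drop (Suc (q ! v)) (W ! v)) \<subseteq> set (drop (Suc (p ! v)) (W ! v))"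
    by (rule set_drop_subset_set_drop)
  then show ?thesis
    using v assms(3) by (intro forbiddenI[of v]) (auto simp: assigned_def)
qed

definition advance :: "nat list \<Rightarrow> nat list" where
  "advance p = map (\<lambda>w. if forbidden p w then Suc (p ! w) else p ! w) [0..<n]"

lemma length_advance [simp]: "length (advance p) = n"
  by (simp add: advance_def)

lemma le_advance: "length p = n \<Longrightarrow> p \<sqsubseteq> advance p"
  by (auto simp: advance_def list_all2_conv_all_nth)

text \<open>All forbidden workers may move at once, since each coordinate is argued separately: if
  \<open>p\<close> and \<open>q\<close> agreed at a forbidden worker, \<open>forbidden_mono\<close>
  would make that worker forbidden in \<open>q\<close>.\<close>

lemma advance_le:
  assumes "q \<in> feasible" "p \<sqsubseteq> q"
  shows "advance p \<sqsubseteq> q"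
proof -
  have len: "length p = n" "length q = n"
    using assms feasibleD(1) by (auto simp: list_all2_conv_all_nth)
  have "advance p ! w \<le> q ! w" if w: "w < n" for w
  proof (cases "forbidden p w")
    case True
    then have "p ! w \<noteq> q ! w"
      using forbidden_mono[OF assms(2) len(1)] feasibleD(3)[OF assms(1) w] by blast
    with assms(2) len w True show ?thesis
      by (auto simp: advance_def list_all2_conv_all_nth Suc_le_eq intro: le_neq_implies_less)
  qed (use assms(2) len w in \<open>auto simp: advance_def list_all2_conv_all_nth\<close>)
  with len show ?thesis
    by (simp add: list_all2_conv_all_nth)
qed

text \<open>The sum of the entries is the potential behind termination in
  \<open>is_least_exists\<close> and behind the number of rounds charged to the closure
  program.\<close>

lemma sum_list_advance_less:
  assumes "length p = n" "advance p \<noteq> p"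
  shows "sum_list p < sum_list (advance p)"
proof -
  have "\<forall>w<n. p ! w \<le> advance p ! w"
    by (simp add: advance_def)
  moreover obtain w where "w < n" "p ! w \<noteq> advance p ! w"
    using assms by (metis length_advance nth_equalityI)
  ultimately have "(\<Sum>w<n. p ! w) < (\<Sum>w<n. advance p ! w)"
    by (intro sum_strict_mono_ex1) (auto intro: le_neq_implies_less)
  then show ?thesis
    using assms by (simp add: sum_list_sum_nth atLeast0LessThan)
qed

lemma sum_list_le: "length p = n \<Longrightarrow> \<forall>w<n. p ! w \<le> k \<Longrightarrow> sum_list p \<le> n * k"
  using sum_bounded_above[of "{..<n}" "(!) p" k] by (simp add: sum_list_sum_nth atLeast0LessThan)

definition is_least :: "nat list \<Rightarrow> nat list \<Rightarrow> bool" where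
  "is_least p r \<longleftrightarrow> r \<in> feasible \<and> p \<sqsubseteq> r \<and> (\<forall>q\<in>feasible. p \<sqsubseteq> q \<longrightarrow> r \<sqsubseteq> q)"

text \<open>Exactly the same feasible vectors lie above \<open>p\<close> and above
  \<open>advance p\<close>.\<close>

lemma is_least_advance:
  assumes "length p = n"
  shows "is_least (advance p) = is_least p"
  using advance_le vec_le_trans[OF le_advance[OF assms]] by (fastforce simp: is_least_def fun_eq_iff)

lemma is_least_fixed:
  assumes "length p = n" "\<forall>w<n. p ! w < n" "advance p = p"
  shows "is_least p p"
proof -
  have "\<not> forbidden p w" if "w < n" for w
    using arg_cong[OF assms(3), of "\<lambda>xs. xs ! w"] that by (auto simp: advance_def split: if_splits)
  then show ?thesis
    using assms(1,2) by (auto simp: is_least_def feasible_def list_all2_refl)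
qed

text \<open>Every iterate of \<open>advance\<close> stays below the given \<open>q\<close>, so the
  gap between the two entry sums is a measure for the iteration.\<close>

lemma is_least_exists:
  assumes "q \<in> feasible" "p \<sqsubseteq> q"
  shows "\<exists>r. is_least p r"
  using assms(2)
proof (induction "sum_list q - sum_list p" arbitrary: p rule: less_induct)
  case less
  have len: "length p = n" and pq: "\<forall>w<n. p ! w \<le> q ! w"
    using less.prems feasibleD(1)[OF assms(1)] by (auto simp: list_all2_conv_all_nth)
  show ?case
  proof (cases "advance p = p")
    case True
    then show ?thesis
      using is_least_fixed[OF len] pq feasibleD(2)[OF assms(1)] by (meson le_less_trans)
  next
    case False
    have le: "advance p \<sqsubseteq> q"
      by (rule advance_le[OF assms(1) less.prems])
    then have "sum_list (advance p) \<le> sum_list q"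
      using feasibleD(1)[OF assms(1)] by (intro sum_list_mono2) (simp_all add: list_all2_conv_all_nth)
    then have "sum_list q - sum_list (advance p) < sum_list q - sum_list p"
      using sum_list_advance_less[OF len False] by linarith
    from less.hyps[OF this le] show ?thesis
      by (simp add: is_least_advance[OF len])
  qed
qed

text \<open>Specified by its value and not by the iteration, which keeps rounds out of the lattice
  arguments. The equations \<open>closure_advance\<close>, \<open>closure_fixed\<close> and
  \<open>closure_overflow\<close> are the ones that the program follows.\<close>

definition closure :: "nat list \<Rightarrow> nat list option" where
  "closure p = (if \<exists>r. is_least p r then Some (THE r. is_least p r) else None)"

lemma closure_eq_Some_iff: "closure p = Some r \<longleftrightarrow> is_least p r"
proof -
  have "r = r'" if "is_least p r" "is_least p r'" for r r'
    using that by (auto simp: is_least_def intro: vec_le_antisym)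
  then show ?thesis
    by (auto simp: closure_def intro: theI)
qed

lemma closure_eq_None_iff: "closure p = None \<longleftrightarrow> (\<forall>q\<in>feasible. \<not> p \<sqsubseteq> q)"
proof -
  have "(\<exists>r. is_least p r) \<longleftrightarrow> (\<exists>q\<in>feasible. p \<sqsubseteq> q)"
    using is_least_exists by (auto simp: is_least_def)
  then show ?thesis
    by (auto simp: closure_def)
qed

lemma closure_SomeD:
  assumes "closure p = Some r"
  shows "r \<in> feasible" "p \<sqsubseteq> r" "q \<in> feasible \<Longrightarrow> p \<sqsubseteq> q \<Longrightarrow> r \<sqsubseteq> q"
  using assms by (auto simp: closure_eq_Some_iff is_least_def)

lemma closure_advance: "length p = n \<Longrightarrow> closure (advance p) = closure p"
  by (simp add: closure_def is_least_advance)

lemma closure_fixed: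
  "length p = n \<Longrightarrow> \<forall>w<n. p ! w < n \<Longrightarrow> advance p = p \<Longrightarrow> closure p = Some p"
  by (simp add: closure_eq_Some_iff is_least_fixed)

lemma closure_overflow: "length p = n \<Longrightarrow> w < n \<Longrightarrow> n \<le> p ! w \<Longrightarrow> closure p = None"
  using feasibleD(2) unfolding closure_eq_None_iff list_all2_conv_all_nth by (metis leD le_trans)

section \<open>Minima and maxima of feasible vectors\<close>

lemma vec_min_feasible:
  assumes p: "p \<in> feasible" and q: "q \<in> feasible"
  shows "vec_min p q \<in> feasible"
proof -
  have len: "length p = n" "length q = n"
    using p q feasibleD(1) by auto
  then have le: "vec_min p q \<sqsubseteq> p" "vec_min p q \<sqsubseteq> q"
    by (auto simp: list_all2_conv_all_nth)
  \<comment> \<open>Both \<open>p\<close> and \<open>q\<close> are feasible vectors above their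
    minimum, so the least such vector lies below both and must be the minimum itself.\<close>
  obtain r where r: "is_least (vec_min p q) r"
    using is_least_exists[OF p le(1)] by blast
  then have "r \<sqsubseteq> p" "r \<sqsubseteq> q"
    using p q le by (auto simp: is_least_def)
  then have "r \<sqsubseteq> vec_min p q"
    by (auto simp: list_all2_conv_all_nth)
  then have "r = vec_min p q"
    using r by (auto simp: is_least_def intro: vec_le_antisym)
  with r show ?thesis
    by (simp add: is_least_def)
qed

text \<open>
  Each worker who is better off under \<open>q\<close> than under \<open>p\<close> is assigned by \<open>q\<close> to a firm that is
  better off under \<open>p\<close>, and each firm that is better off under \<open>p\<close> is assigned by \<open>p\<close> to such a
  worker. Counting shows that these workers have the same firms under \<open>p\<close> as under \<open>q\<close>.
\<close>

lemma opposite_interests: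
  assumes p: "p \<in> feasible" and q: "q \<in> feasible" and I: "I \<in> {A, B}"
    and w: "w < n" "q ! w < p ! w" and u: "u < n" "assigned q u = assigned p w"
  shows "firm_prefers I (assigned p w) w u"
proof -
  define S where "S = {w. w < n \<and> q ! w < p ! w}"
  define Y where "Y = {f. \<exists>w u. w < n \<and> u < n \<and> assigned p w = f \<and> assigned q u = f \<and>
    firm_prefers I f w u}"
  have inj: "inj_on (assigned p) S" "inj_on (assigned q) S"
    using assigned_inj[OF p] assigned_inj[OF q] by (auto intro: inj_on_subset simp: S_def)
  have "assigned q ` S \<subseteq> Y"
  proof
    fix f
    assume "f \<in> assigned q ` S"
    then obtain v where v: "v < n" "q ! v < p ! v" "f = assigned q v"
      by (auto simp: S_def)
    have f: "f < n"
      using v feasibleD(4)[OF q] by simp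
    obtain x where x: "x < n" "assigned p x = f"
      using assigned_surj[OF p f] .
    have "assigned p v \<noteq> assigned q v"
      using v feasibleD(2)[OF p] feasibleD(2)[OF q] W_nth_eq_iff[OF v(1)] by (simp add: assigned_def)
    then have "x \<noteq> v"
      using x v by auto
    have "f \<notin> set (drop (Suc (p ! v)) (W ! v))"
      using v feasibleD(2)[OF q] by (simp add: assigned_def nth_in_drop_Suc_iff)
    then have "\<not> firm_prefers I f v x"
      using feasibleD(3)[OF p x(1)] x(2) v(1) I by (auto intro: forbiddenI prefers_eitherI)
    then have "firm_prefers I f x v"
      using firm_prefers_linear[OF I f x(1) v(1) \<open>x \<noteq> v\<close>] by blast
    then show "f \<in> Y"
      using x v by (auto simp: Y_def)
  qed
  moreover have "Y \<subseteq> assigned p ` S"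
  proof
    fix f
    assume "f \<in> Y"
    then obtain x v where x: "x < n" "assigned p x = f" and v: "v < n" "assigned q v = f"
      and pref: "firm_prefers I f x v"
      by (auto simp: Y_def)
    have "f \<in> set (drop (Suc (q ! x)) (W ! x))"
      using feasibleD(3)[OF q v(1)] v(2) x(1) I pref by (auto intro: forbiddenI prefers_eitherI)
    then have "q ! x < p ! x"
      using x feasibleD(2)[OF p] nth_in_drop_Suc_iff[of x "p ! x"] by (simp add: assigned_def)
    then show "f \<in> assigned p ` S"
      using x by (auto simp: S_def)
  qed
  moreover have "finite (assigned p ` S)" "card (assigned p ` S) = card (assigned q ` S)"
    using inj by (auto simp: card_image S_def)
  ultimately have "assigned p ` S = Y"
    by (metis card_subset_eq order.antisym order.trans)
  then have "assigned p w \<in> Y"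
    using w by (auto simp: S_def)
  then obtain w' u' where *: "w' < n" "u' < n" "assigned p w' = assigned p w"
    "assigned q u' = assigned p w" "firm_prefers I (assigned p w) w' u'"
    by (auto simp: Y_def)
  have "w' = w" "u' = u"
    using * w u assigned_inj[OF p] assigned_inj[OF q] by (auto simp: inj_on_def)
  with * show ?thesis
    by simp
qed

text \<open>Let \<open>f\<close> be the firm of \<open>w\<close> under \<open>p\<close> and
  \<open>u\<close> its worker under \<open>q\<close>. If \<open>v\<close> forbade \<open>w\<close>
  in the maximum, \<open>f\<close> would rank \<open>v\<close> above \<open>w\<close> and, when
  \<open>u\<close> differs from \<open>w\<close>, also \<open>w\<close> above \<open>u\<close> by
  \<open>opposite_interests\<close>. Transitivity in this one instance then lets \<open>v\<close>
  forbid \<open>u\<close> in \<open>q\<close>.\<close>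

lemma not_forbidden_vec_max:
  assumes p: "p \<in> feasible" and q: "q \<in> feasible" and w: "w < n" "q ! w \<le> p ! w"
  shows "\<not> forbidden (vec_max p q) w"
proof
  let ?r = "vec_max p q" and ?f = "assigned p w"
  have r: "?r ! v = max (p ! v) (q ! v)" if "v < n" for v
    using that feasibleD(1)[OF p] feasibleD(1)[OF q] by simp
  have f: "assigned ?r w = ?f" "?f < n"
    using w r feasibleD(4)[OF p] by (auto simp: assigned_def)
  assume "forbidden ?r w"
  then obtain v I where v: "v < n" "?f \<notin> set (drop (Suc (?r ! v)) (W ! v))"
    and I: "I \<in> {A, B}" "firm_prefers I ?f v w"
    using f(1) by (auto simp: forbidden_def prefers_either_def)
  \<comment> \<open>As \<open>v\<close> does not forbid \<open>w\<close> in \<open>p\<close>, it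
    must rank \<open>?f\<close> after its assignment under \<open>p\<close>. The entry of the
    maximum at \<open>v\<close> therefore comes from \<open>q\<close>.\<close>
  have "?f \<in> set (drop (Suc (p ! v)) (W ! v))"
    using feasibleD(3)[OF p w(1)] v(1) I by (auto intro: forbiddenI prefers_eitherI)
  with v r have q_v: "?f \<notin> set (drop (Suc (q ! v)) (W ! v))"
    by (auto simp: max_def split: if_splits)
  obtain u where u: "u < n" "assigned q u = ?f"
    using assigned_surj[OF q f(2)] .
  have not_pref: "\<not> firm_prefers I ?f v u"
    using feasibleD(3)[OF q u(1)] forbiddenI[of v q u] u v(1) q_v I(1) prefers_eitherI[OF I(1), of ?f v u]
    by auto
  show False
  proof (cases "q ! w = p ! w")
    case True
    then have "assigned q w = ?f"
      by (simp add: assigned_def)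
    then have "u = w"
      using u w assigned_inj[OF q] by (auto simp: inj_on_def)
    with not_pref I show False
      by simp
  next
    case False
    then have "firm_prefers I ?f w u"
      using opposite_interests[OF p q I(1) w(1) _ u] w by simp
    then show False
      using not_pref firm_prefers_trans[OF I(1) f(2) I(2)] by blast
  qed
qed

lemma vec_max_feasible:
  assumes p: "p \<in> feasible" and q: "q \<in> feasible"
  shows "vec_max p q \<in> feasible"
proof -
  have len: "length p = n" "length q = n"
    using p q feasibleD(1) by auto
  have comm: "vec_max q p = vec_max p q"
    using len by (intro nth_equalityI) (auto simp: max.commute)
  have "\<not> forbidden (vec_max p q) w" if "w < n" for w
    using not_forbidden_vec_max[OF p q that] not_forbidden_vec_max[OF q p that] comm
    by (cases "q ! w \<le> p ! w") auto
  moreover have "vec_max p q ! w < n" if "w < n" for w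
    using that len feasibleD(2)[OF p that] feasibleD(2)[OF q that] by simp
  ultimately show ?thesis
    using len by (simp add: feasible_def)
qed

lemma finite_feasible: "finite feasible"
proof (rule finite_subset)
  show "feasible \<subseteq> {p. set p \<subseteq> {..<n} \<and> length p = n}"
    by (auto simp: feasible_def in_set_conv_nth)
  show "finite {p. set p \<subseteq> {..<n} \<and> length p = n}"
    by (simp add: finite_lists_length_eq)
qed

end

section \<open>The Birkhoff order of the generators\<close>

context common_instances
begin

text \<open>Each generator is least for a bound at a single coordinate, and a maximum reaches such a
  bound iff one of its terms does. This recovers a closed set from its join. The bottom is left out
  because it lies below the join of the empty set.\<close>

lemma birkhoff_order_common:
  assumes bottom: "closure (replicate n 0) = Some bottom"
    and gs: "distinct gs"
      "set gs = {g. \<exists>w<n. \<exists>k<n. closure ((replicate n 0)[w := k]) = Some g} - {bottom}"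
  shows "birkhoff_order n A (stable_matchings n A \<inter> stable_matchings n B) {..<length gs}
    {(i, j). i < length gs \<and> j < length gs \<and> gs ! i \<sqsubseteq> gs ! j}"
    (is "birkhoff_order n A ?S ?C ?R")
proof -
  have bot_feasible: "bottom \<in> feasible"
    using closure_SomeD[OF bottom] by simp
  have bot_le: "bottom \<sqsubseteq> q" if "q \<in> feasible" for q
    using closure_SomeD(3)[OF bottom that] feasibleD(1)[OF that] by (simp add: list_all2_conv_all_nth)
  have g: "gs ! i \<in> feasible" "length (gs ! i) = n" if "i < length gs" for i
  proof -
    have "gs ! i \<in> set gs"
      using that by simp
    then show "gs ! i \<in> feasible"
      unfolding gs(2) using closure_SomeD(1) by blast
    then show "length (gs ! i) = n"
      by (rule feasibleD)
  qed
  have bound_le_iff: "(replicate n 0)[w := k] \<sqsubseteq> q \<longleftrightarrow> k \<le> q ! w" if "length q = n" "w < n" for q w k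
    using that by (auto simp: list_all2_conv_all_nth nth_list_update)
  \<comment> \<open>The entry of \<open>bottom\<close> gives the empty closed set its image. It
    changes no other join, since all generators lie above \<open>bottom\<close>.\<close>
  define join_of where "join_of X = map (\<lambda>w. Max (insert (bottom ! w) ((\<lambda>i. gs ! i ! w) ` X))) [0..<n]" for X
  define below where "below q = {i. i < length gs \<and> gs ! i \<sqsubseteq> q}" for q
  have length_join_of: "length (join_of X) = n" for X
    by (simp add: join_of_def)
  have join_of_le_iff: "join_of X ! w \<le> k \<longleftrightarrow> bottom ! w \<le> k \<and> (\<forall>i\<in>X. gs ! i ! w \<le> k)"
    if "finite X" "w < n" for X w k
    using that by (simp add: join_of_def)
  have join_of_empty: "join_of {} = bottom"
    using feasibleD(1)[OF bot_feasible] by (auto simp: join_of_def intro: nth_equalityI)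
  have join_of_insert: "join_of (insert i X) = vec_max (gs ! i) (join_of X)" if "finite X" "i < length gs" for i X
    using that g(2) by (intro nth_equalityI) (auto simp: join_of_def insert_commute[of _ "gs ! i ! _"])
  have join_of_feasible: "join_of X \<in> feasible" if "X \<subseteq> ?C" for X
    using finite_subset[OF that finite_lessThan] that
    by (induction) (auto simp: join_of_empty bot_feasible join_of_insert g vec_max_feasible)
  have join_of_Un: "join_of (X \<union> Y) = vec_max (join_of X) (join_of Y)" if "finite X" "finite Y" for X Y
  proof (rule nth_equalityI)
    fix w
    assume "w < length (join_of (X \<union> Y))"
    then have w: "w < n"
      by (simp add: length_join_of)
    have "join_of (X \<union> Y) ! w \<le> k \<longleftrightarrow> vec_max (join_of X) (join_of Y) ! w \<le> k" for k
      using that w by (auto simp: join_of_le_iff length_join_of)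
    then show "join_of (X \<union> Y) ! w = vec_max (join_of X) (join_of Y) ! w"
      by (meson order.antisym order.refl)
  qed (simp add: length_join_of)
  have below_closed: "below q \<in> closed_sets ?C ?R" for q
    using vec_le_trans by (fastforce simp: below_def closed_sets_def)
  have below_join_of: "below (join_of X) = X" if X: "X \<in> closed_sets ?C ?R" for X
  proof (intro equalityI subsetI)
    have XC: "X \<subseteq> ?C" and fin: "finite X"
      using X finite_subset[of X ?C] by (auto simp: closed_sets_def)
    fix i
    show "i \<in> X" if "i \<in> below (join_of X)"
    proof -
      have i: "i < length gs" "gs ! i \<sqsubseteq> join_of X"
        using that by (auto simp: below_def)
      then have "gs ! i \<in> set gs"
        by simp
      then obtain w k where wk: "w < n" "closure ((replicate n 0)[w := k]) = Some (gs ! i)"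
        and not_bot: "gs ! i \<noteq> bottom"
        unfolding gs(2) by blast
      have "k \<le> gs ! i ! w"
        using closure_SomeD(2)[OF wk(2)] bound_le_iff[OF g(2)[OF i(1)] wk(1)] by simp
      have least: "gs ! i \<sqsubseteq> q" if "q \<in> feasible" "k \<le> q ! w" for q
        using closure_SomeD(3)[OF wk(2) that(1)] bound_le_iff[OF feasibleD(1)[OF that(1)] wk(1)] that(2)
        by simp
      \<comment> \<open>Otherwise \<open>bottom\<close> would meet the bound, and the least vector
        \<open>gs ! i\<close> would be \<open>bottom\<close>. So the bound \<open>k\<close> is
        reached in the join by a generator and not by the default term.\<close>
      have "\<not> k \<le> bottom ! w"
        using least[OF bot_feasible] bot_le[OF g(1)[OF i(1)]] not_bot vec_le_antisym by blast
      moreover have "k \<le> join_of X ! w"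
        using \<open>k \<le> gs ! i ! w\<close> i(2) wk(1) by (auto simp: list_all2_conv_all_nth length_join_of)
      \<comment> \<open>Since \<open>k\<close> is positive, reaching \<open>k\<close> is the
        negation of being at most \<open>k - 1\<close>, to which \<open>join_of_le_iff\<close>
        applies.\<close>
      ultimately obtain j where j: "j \<in> X" "k \<le> gs ! j ! w"
        using join_of_le_iff[OF fin wk(1), of "k - 1"]
        by (metis (no_types, lifting) Suc_pred' not_gr_zero not_less_eq_eq zero_le)
      then have "gs ! i \<sqsubseteq> gs ! j" "j < length gs"
        using least g XC by auto
      then show "i \<in> X"
        using X j i by (auto simp: closed_sets_def)
    qed
    show "i \<in> below (join_of X)" if "i \<in> X"
    proof -
      have "gs ! i ! w \<le> join_of X ! w" if "w < n" for w
        using join_of_le_iff[OF fin that, of "join_of X ! w"] \<open>i \<in> X\<close> by auto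
      then show ?thesis
        using that XC g by (auto simp: below_def list_all2_conv_all_nth length_join_of)
    qed
  qed
  have join_of_below: "join_of (below q) = q" if q: "q \<in> feasible" for q
  proof (rule vec_le_antisym)
    have fin: "finite (below q)"
      by (simp add: below_def)
    have len: "length q = n"
      by (rule feasibleD(1)[OF q])
    show "join_of (below q) \<sqsubseteq> q"
      using bot_le[OF q] len join_of_le_iff[OF fin]
      by (auto simp: list_all2_conv_all_nth length_join_of below_def)
    have "q ! w \<le> join_of (below q) ! w" if w: "w < n" for w
    proof -
      \<comment> \<open>The least vector for the bound \<open>q ! w\<close> at coordinate
        \<open>w\<close> lies below \<open>q\<close> and attains \<open>q ! w\<close> there. Such
        vectors for all \<open>w\<close> have \<open>q\<close> as their join.\<close>
      let ?p = "(replicate n 0)[w := q ! w]"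
      have "?p \<sqsubseteq> q"
        using bound_le_iff[OF len w] by simp
      then obtain r where r: "closure ?p = Some r"
        using q closure_eq_None_iff[of ?p] by blast
      have rw: "q ! w \<le> r ! w"
        using closure_SomeD(1,2)[OF r] bound_le_iff[of r] w feasibleD(1) by blast
      have "r \<sqsubseteq> q"
        using closure_SomeD(3)[OF r q \<open>?p \<sqsubseteq> q\<close>] .
      show ?thesis
      proof (cases "r = bottom")
        case True
        then show ?thesis
          using rw join_of_le_iff[OF fin w, of "join_of (below q) ! w"] by simp
      next
        case False
        then have "r \<in> set gs"
          unfolding gs(2) using r w feasibleD(2)[OF q w] by blast
        then obtain i where "i < length gs" "gs ! i = r"
          by (auto simp: in_set_conv_nth)
        then show ?thesis
          using rw \<open>r \<sqsubseteq> q\<close> join_of_le_iff[OF fin w, of "join_of (below q) ! w"]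
          by (fastforce simp: below_def)
      qed
    qed
    then show "q \<sqsubseteq> join_of (below q)"
      using len by (simp add: list_all2_conv_all_nth length_join_of)
  qed
  have join_of_closed: "join_of X \<in> feasible" if "X \<in> closed_sets ?C ?R" for X
    using that join_of_feasible by (auto simp: closed_sets_def)
  have join_of_bij: "bij_betw join_of (closed_sets ?C ?R) feasible"
    by (rule bij_betw_byWitness[where f' = below])
      (use below_join_of join_of_below join_of_closed below_closed in auto)
  have "bij_betw (matching_at \<circ> join_of) (closed_sets ?C ?R) ?S"
    using bij_betw_trans[OF join_of_bij matching_at_bij] .
  moreover have "(X \<subseteq> Y \<longleftrightarrow> matching_le n A (matching_at (join_of X)) (matching_at (join_of Y))) \<and>
      matching_at (join_of (X \<union> Y)) = matching_join n A (matching_at (join_of X)) (matching_at (join_of Y)) \<and>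
      matching_at (join_of (X \<inter> Y)) = matching_meet n A (matching_at (join_of X)) (matching_at (join_of Y))"
    if X: "X \<in> closed_sets ?C ?R" and Y: "Y \<in> closed_sets ?C ?R" for X Y
  proof -
    have fin: "finite X" "finite Y"
      using X Y finite_subset[OF _ finite_lessThan] by (auto simp: closed_sets_def)
    have below_min: "below (vec_min p q) = below p \<inter> below q" if "length p = n" "length q = n" for p q
      using that by (auto simp: below_def list_all2_conv_all_nth)
    have "X \<subseteq> Y \<longleftrightarrow> join_of X \<sqsubseteq> join_of Y"
    proof
      assume "X \<subseteq> Y"
      then show "join_of X \<sqsubseteq> join_of Y"
        using fin by (auto simp: list_all2_conv_all_nth length_join_of join_of_le_iff join_of_def)
    next
      assume "join_of X \<sqsubseteq> join_of Y"
      then have "below (join_of X) \<subseteq> below (join_of Y)"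
        using vec_le_trans by (auto simp: below_def)
      then show "X \<subseteq> Y"
        using below_join_of X Y by simp
    qed
    moreover have "join_of (X \<inter> Y) = vec_min (join_of X) (join_of Y)"
    proof -
      \<comment> \<open>Meets are transported through the inverse map: \<open>below\<close> turns
        minima into intersections.\<close>
      have "X \<inter> Y = below (vec_min (join_of X) (join_of Y))"
        using below_min[of "join_of X" "join_of Y"] below_join_of X Y by (simp add: length_join_of)
      then show ?thesis
        using join_of_below vec_min_feasible join_of_closed X Y by simp
    qed
    ultimately show ?thesis
      using join_of_Un[OF fin] X Y join_of_closed
      by (simp add: matching_le_iff matching_join_at matching_meet_at)
  qed
  moreover have "partial_order_on ?C ?R"
  proof -
    have "gs ! i \<sqsubseteq> gs ! i" for i
      by (simp add: list_all2_refl)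
    moreover have "i = j" if "i < length gs" "j < length gs" "gs ! i \<sqsubseteq> gs ! j" "gs ! j \<sqsubseteq> gs ! i" for i j
      using vec_le_antisym[OF that(3,4)] that(1,2) gs(1) by (simp add: nth_eq_iff_index_eq)
    ultimately show ?thesis
      using vec_le_trans
      by (auto simp: partial_order_on_def preorder_on_def refl_on_def intro!: antisymI transI)
  qed
  ultimately show ?thesis
    unfolding birkhoff_order_def by (intro conjI exI[of _ "matching_at \<circ> join_of"]) auto
qed

section \<open>Lexicographic successors of feasible vectors\<close>

abbreviation lex_less :: "nat list \<Rightarrow> nat list \<Rightarrow> bool" (infix "\<prec>" 50) where
  "p \<prec> q \<equiv> (p, q) \<in> lexord {(x, y). x < y}"

definition raised :: "nat list \<Rightarrow> nat \<Rightarrow> nat list" where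
  "raised p w = take w p @ Suc (p ! w) # replicate (n - Suc w) 0"

primrec next_from :: "nat list \<Rightarrow> nat \<Rightarrow> nat list option" where
  "next_from p 0 = None"
| "next_from p (Suc w) =
     (case closure (raised p w) of
        None \<Rightarrow> next_from p w
      | Some q \<Rightarrow> if take w q = take w p then Some q else next_from p w)"

lemma raised_le_iff:
  assumes "length p = n" "length q = n" "w < n" "take w q = take w p"
  shows "raised p w \<sqsubseteq> q \<longleftrightarrow> p ! w < q ! w"
proof -
  have "q ! i = p ! i" if "i < w" for i
    using assms(4) that by (metis nth_take)
  then show ?thesis
    using assms by (auto simp: raised_def list_all2_conv_all_nth nth_append nth_Cons' Suc_le_eq)
qed


lemma take_le_of_raised_le:
  assumes "raised p w \<sqsubseteq> q" "length p = n" "w < n"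
  shows "take w p \<sqsubseteq> take w q" "Suc (p ! w) \<le> q ! w"
proof -
  have "take w (raised p w) \<sqsubseteq> take w q"
    using assms(1) by (rule list_all2_takeI)
  then show "take w p \<sqsubseteq> take w q"
    using assms(2,3) by (simp add: raised_def)
  show "Suc (p ! w) \<le> q ! w"
    using assms by (auto simp: raised_def list_all2_conv_all_nth nth_append dest: spec[of _ w])
qed

text \<open>The vectors after \<open>p\<close> are split by the coordinate at which they first
  exceed \<open>p\<close>. A later coordinate gives lexicographically smaller vectors, so the search
  goes from the last coordinate backwards and stops at the first nonempty class.\<close>

lemma next_from_correct:
  assumes "length p = n" "w \<le> n"
  defines "later \<equiv> {q \<in> feasible. \<exists>i<w. take i p = take i q \<and> p ! i < q ! i}"
  shows "(next_from p w = None \<longrightarrow> later = {}) \<and>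
    (\<forall>q. next_from p w = Some q \<longrightarrow> q \<in> later \<and> (\<forall>r\<in>later. r = q \<or> q \<prec> r))"
  using assms(2) unfolding later_def
proof (induction w)
  case (Suc w)
  let ?later = "\<lambda>w. {q \<in> feasible. \<exists>i<w. take i p = take i q \<and> p ! i < q ! i}"
  let ?here = "{q \<in> feasible. take w q = take w p \<and> p ! w < q ! w}"
  have w: "w < n"
    using Suc.prems by simp
  have later_Suc: "?later (Suc w) = ?later w \<union> ?here"
    by (auto simp: less_Suc_eq)
  have below_here: "raised p w \<sqsubseteq> r" if "r \<in> ?here" for r
    using that raised_le_iff[OF assms(1) _ w] feasibleD(1) by auto
  show ?case
  proof (cases "\<exists>q. closure (raised p w) = Some q \<and> take w q = take w p")
    case True
    then obtain q where q: "closure (raised p w) = Some q" "take w q = take w p"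
      by blast
    note q_feasible = closure_SomeD(1)[OF q(1)]
    have "q \<in> ?here"
      using q closure_SomeD(2)[OF q(1)] raised_le_iff[OF assms(1) _ w q(2)] q_feasible feasibleD(1)
      by auto
    moreover have "r = q \<or> q \<prec> r" if "r \<in> ?here" for r
      using closure_SomeD(3)[OF q(1) _ below_here[OF that]] that vec_le_imp_lexord by blast
    \<comment> \<open>Before \<open>w\<close> the vector \<open>q\<close> agrees with
      \<open>p\<close>, so a vector that first exceeds \<open>p\<close> at \<open>i < w\<close>
      exceeds \<open>q\<close> at the same place.\<close>
    moreover have "q \<prec> r" if r: "r \<in> ?later w" for r
    proof -
      obtain i where i: "i < w" "take i p = take i r" "p ! i < r ! i"
        using r by blast
      have "take i q = take i r" "q ! i = p ! i"
        using i q(2) by (metis min.strict_order_iff take_take) (metis i(1) nth_take q(2))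
      then show ?thesis
        using i(1,3) w r feasibleD(1) q_feasible lexord_equal_length_iff[of q n r]
        by (auto intro!: exI[of _ i])
    qed
    ultimately show ?thesis
      unfolding later_Suc using q by auto
  next
    case False
    have here_empty: "?here = {}"
    proof (rule equals0I)
      fix r
      assume r: "r \<in> ?here"
      then obtain q where q: "closure (raised p w) = Some q"
        using below_here closure_eq_None_iff[of "raised p w"] by blast
      \<comment> \<open>The least vector \<open>q\<close> lies between \<open>raised p w\<close> and
        \<open>r\<close>. Both have the prefix \<open>take w p\<close>, so \<open>q\<close> has it
        too, contrary to the failed test.\<close>
      have "q \<sqsubseteq> r"
        using closure_SomeD(3)[OF q _ below_here[OF r]] r by blast
      then have "take w q \<sqsubseteq> take w p"
        using r list_all2_takeI[of "(\<le>)" q r w] by auto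
      then have "take w q = take w p"
        using take_le_of_raised_le(1)[OF closure_SomeD(2)[OF q] assms(1) w] by (intro vec_le_antisym)
      with False q show False
        by blast
    qed
    have same: "next_from p (Suc w) = next_from p w"
      using False by (auto split: option.splits)
    show ?thesis
      unfolding same later_Suc here_empty using Suc.IH w by simp
  qed
qed simp

definition next_feasible :: "nat list \<Rightarrow> nat list option" where
  "next_feasible p = next_from p n"

lemma next_feasible_None:
  assumes "p \<in> feasible" "next_feasible p = None"
  shows "{q \<in> feasible. p \<prec> q} = {}"
  using next_from_correct[OF feasibleD(1)[OF assms(1)] le_refl] assms
    lexord_equal_length_iff feasibleD(1) by (auto simp: next_feasible_def)

text \<open>The third claim peels one vector off those still to come and drives the induction over
  the enumeration.\<close>

lemma next_feasible_Some:
  assumes "p \<in> feasible" "next_feasible p = Some q"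
  shows "q \<in> feasible" "p \<prec> q" "{r \<in> feasible. p \<prec> r} = insert q {r \<in> feasible. q \<prec> r}"
proof -
  have later: "{q \<in> feasible. \<exists>i<n. take i p = take i q \<and> p ! i < q ! i} = {q \<in> feasible. p \<prec> q}"
    using lexord_equal_length_iff[OF feasibleD(1)[OF assms(1)]] feasibleD(1) by auto
  have *: "q \<in> {q \<in> feasible. p \<prec> q}" "\<forall>r\<in>{q \<in> feasible. p \<prec> q}. r = q \<or> q \<prec> r"
    using next_from_correct[OF feasibleD(1)[OF assms(1)] le_refl, unfolded later] assms(2)
    by (auto simp: next_feasible_def)
  then show "q \<in> feasible" "p \<prec> q"
    by auto
  have "p \<prec> r" if "q \<prec> r" for r
    using lexord_trans[OF \<open>p \<prec> q\<close> that] by (auto simp: trans_def)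
  with * show "{r \<in> feasible. p \<prec> r} = insert q {r \<in> feasible. q \<prec> r}"
    by auto
qed

end

section \<open>Running times of programs\<close>

text \<open>
  Weakest preconditions of runs without outputs; the postcondition sees the result and the
  number of steps.
\<close>

definition wp :: "program \<Rightarrow> sexp list \<Rightarrow> expr \<Rightarrow> (sexp \<Rightarrow> nat \<Rightarrow> bool) \<Rightarrow> bool" where
  "wp P env e Q \<longleftrightarrow> (\<exists>t v. exec P env e t v \<and> set t \<subseteq> {Step} \<and> Q v (length t))"

definition wps :: "program \<Rightarrow> sexp list \<Rightarrow> expr list \<Rightarrow> (sexp list \<Rightarrow> nat \<Rightarrow> bool) \<Rightarrow> bool" where
  "wps P env es Q \<longleftrightarrow> (\<exists>t vs. execs P env es t vs \<and> set t \<subseteq> {Step} \<and> Q vs (length t))"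

definition wp_call :: "program \<Rightarrow> nat \<Rightarrow> sexp list \<Rightarrow> (sexp \<Rightarrow> nat \<Rightarrow> bool) \<Rightarrow> bool" where
  "wp_call P f vs Q \<longleftrightarrow> f < length P \<and> wp P vs (P ! f) Q"

text \<open>Equivalences, so that the simplifier unfolds a whole body and stops at
  \<open>wp_call\<close>. There is no rule for \<open>EEmit\<close>, whose traces contain an output
  and thus lie outside \<open>wp\<close>.\<close>

lemma wp_simps [simp]:
  "wp P env (EVar i) Q \<longleftrightarrow> i < length env \<and> Q (env ! i) 1"
  "wp P env ELeaf Q \<longleftrightarrow> Q Leaf 1"
  "wp P env (ENode e1 e2) Q \<longleftrightarrow>
     wp P env e1 (\<lambda>v1 t1. wp P env e2 (\<lambda>v2 t2. Q (Node v1 v2) (t1 + t2 + 1)))"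
  "wp P env (EFst e1) Q \<longleftrightarrow> wp P env e1 (\<lambda>v t. Q (sexp_fst v) (t + 1))"
  "wp P env (ESnd e1) Q \<longleftrightarrow> wp P env e1 (\<lambda>v t. Q (sexp_snd v) (t + 1))"
  "wp P env (EIf e1 e2 e3) Q \<longleftrightarrow>
     wp P env e1 (\<lambda>v t. if v = Leaf then wp P env e3 (\<lambda>v' t'. Q v' (t + 1 + t'))
                        else wp P env e2 (\<lambda>v' t'. Q v' (t + 1 + t')))"
  "wp P env (ELet e1 e2) Q \<longleftrightarrow>
     wp P env e1 (\<lambda>v t. wp P (v # env) e2 (\<lambda>v' t'. Q v' (t + 1 + t')))"
  "wp P env (ECall f es) Q \<longleftrightarrow>
     wps P env es (\<lambda>vs t. wp_call P f vs (\<lambda>v t'. Q v (t + 1 + t')))"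
proof -
  show "wp P env (EVar i) Q \<longleftrightarrow> i < length env \<and> Q (env ! i) 1"
    by (auto simp: wp_def elim: exec.cases intro!: exec_execs.intros exI)
  show "wp P env ELeaf Q \<longleftrightarrow> Q Leaf 1"
    by (auto simp: wp_def elim: exec.cases intro!: exec_execs.intros exI)
  show "wp P env (ENode e1 e2) Q \<longleftrightarrow>
     wp P env e1 (\<lambda>v1 t1. wp P env e2 (\<lambda>v2 t2. Q (Node v1 v2) (t1 + t2 + 1)))" (is "?L = ?R")
  proof
    assume ?L
    then show ?R unfolding wp_def
      by (elim exE conjE) (erule exec.cases; fastforce simp: add.assoc)
  next
    assume ?R
    then show ?L unfolding wp_def using ex_Node by fastforce
  qed
  show "wp P env (EFst e1) Q \<longleftrightarrow> wp P env e1 (\<lambda>v t. Q (sexp_fst v) (t + 1))" (is "?L = ?R")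
  proof
    assume ?L
    then show ?R unfolding wp_def by (elim exE conjE) (erule exec.cases; fastforce)
  next
    assume ?R
    then show ?L unfolding wp_def using ex_Fst by fastforce
  qed
  show "wp P env (ESnd e1) Q \<longleftrightarrow> wp P env e1 (\<lambda>v t. Q (sexp_snd v) (t + 1))" (is "?L = ?R")
  proof
    assume ?L
    then show ?R unfolding wp_def by (elim exE conjE) (erule exec.cases; fastforce)
  next
    assume ?R
    then show ?L unfolding wp_def using ex_Snd by fastforce
  qed
  show "wp P env (EIf e1 e2 e3) Q \<longleftrightarrow>
     wp P env e1 (\<lambda>v t. if v = Leaf then wp P env e3 (\<lambda>v' t'. Q v' (t + 1 + t'))
                        else wp P env e2 (\<lambda>v' t'. Q v' (t + 1 + t')))" (is "?L = ?R")
  proof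
    assume ?L
    then show ?R unfolding wp_def
      by (elim exE conjE) (erule exec.cases; fastforce)
  next
    assume ?R
    then obtain t v where 1: "exec P env e1 t v" "set t \<subseteq> {Step}"
      and 2: "if v = Leaf then wp P env e3 (\<lambda>v' t'. Q v' (length t + 1 + t'))
              else wp P env e2 (\<lambda>v' t'. Q v' (length t + 1 + t'))"
      unfolding wp_def[of _ _ e1] by blast
    show ?L
    proof (cases "v = Leaf")
      case True
      with 2 obtain t' v' where "exec P env e3 t' v'" "set t' \<subseteq> {Step}"
        "Q v' (length t + 1 + length t')" by (auto simp: wp_def)
      with ex_If_false[OF 1(1) True, of e3 t' v' e2] 1(2) show ?thesis
        unfolding wp_def by (intro exI[of _ "t @ [Step] @ t'"] exI[of _ v']) simp
    next
      case False
      with 2 obtain t' v' where "exec P env e2 t' v'" "set t' \<subseteq> {Step}"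
        "Q v' (length t + 1 + length t')" by (auto simp: wp_def)
      with ex_If_true[OF 1(1) False, of e2 t' v' e3] 1(2) show ?thesis
        unfolding wp_def by (intro exI[of _ "t @ [Step] @ t'"] exI[of _ v']) simp
    qed
  qed
  show "wp P env (ELet e1 e2) Q \<longleftrightarrow>
     wp P env e1 (\<lambda>v t. wp P (v # env) e2 (\<lambda>v' t'. Q v' (t + 1 + t')))" (is "?L = ?R")
  proof
    assume ?L
    then show ?R unfolding wp_def by (elim exE conjE) (erule exec.cases; fastforce)
  next
    assume ?R
    then show ?L unfolding wp_def using ex_Let by fastforce
  qed
  show "wp P env (ECall f es) Q \<longleftrightarrow>
     wps P env es (\<lambda>vs t. wp_call P f vs (\<lambda>v t'. Q v (t + 1 + t')))" (is "?L = ?R")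
  proof
    assume ?L
    then show ?R unfolding wp_def wps_def wp_call_def
      by (elim exE conjE) (erule exec.cases; fastforce)
  next
    assume ?R
    then show ?L unfolding wp_def wps_def wp_call_def using ex_Call by fastforce
  qed
qed

lemma wps_simps [simp]:
  "wps P env [] Q \<longleftrightarrow> Q [] 0"
  "wps P env (e # es) Q \<longleftrightarrow> wp P env e (\<lambda>v t. wps P env es (\<lambda>vs t'. Q (v # vs) (t + t')))"
proof -
  show "wps P env [] Q \<longleftrightarrow> Q [] 0"
    by (auto simp: wps_def elim: execs.cases intro!: exec_execs.intros exI)
  show "wps P env (e # es) Q \<longleftrightarrow>
     wp P env e (\<lambda>v t. wps P env es (\<lambda>vs t'. Q (v # vs) (t + t')))" (is "?L = ?R")
  proof
    assume ?L
    then show ?R unfolding wp_def wps_def by (elim exE conjE) (erule execs.cases; fastforce)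
  next
    assume ?R
    then show ?L unfolding wp_def wps_def using exs_Cons by fastforce
  qed
qed

definition call_returns :: "program \<Rightarrow> nat \<Rightarrow> sexp list \<Rightarrow> sexp \<Rightarrow> nat \<Rightarrow> bool" where
  "call_returns P f vs r T \<longleftrightarrow> wp_call P f vs (\<lambda>v t. v = r \<and> t \<le> T)"

text \<open>Makes a proved specification of a call an introduction rule. Once
  \<open>wp_simps\<close> has unfolded a body, such rules discharge its calls and leave arithmetic
  on step counts.\<close>

lemma wp_callI:
  assumes "call_returns P f vs r T" "\<And>t. t \<le> T \<Longrightarrow> Q r t"
  shows "wp_call P f vs Q"
  using assms by (auto simp: call_returns_def wp_call_def wp_def)

lemma call_returnsI:
  "f < length P \<Longrightarrow> P ! f = e \<Longrightarrow> wp P vs e (\<lambda>v t. v = r \<and> t \<le> T) \<Longrightarrow> call_returns P f vs r T"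
  by (simp add: call_returns_def wp_call_def)

lemma call_returns_mono: "call_returns P f vs r T \<Longrightarrow> T \<le> T' \<Longrightarrow> call_returns P f vs r T'"
  unfolding call_returns_def wp_call_def wp_def by fastforce

section \<open>The programs\<close>

text \<open>\<open>Suc 0\<close> instead of \<open>1\<close>, since the simplifier rewrites the latter to the former.\<close>

abbreviation (input) fn_eq :: nat where "fn_eq \<equiv> Suc 0"
abbreviation (input) fn_mem :: nat where "fn_mem \<equiv> 2"
abbreviation (input) fn_nth :: nat where "fn_nth \<equiv> 3"
abbreviation (input) fn_precedes :: nat where "fn_precedes \<equiv> 4"
abbreviation (input) fn_forbidden :: nat where "fn_forbidden \<equiv> 5"
abbreviation (input) fn_advance :: nat where "fn_advance \<equiv> 6"
abbreviation (input) fn_closure :: nat where "fn_closure \<equiv> 7"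
abbreviation (input) fn_splice :: nat where "fn_splice \<equiv> 8"
abbreviation (input) fn_vec_le :: nat where "fn_vec_le \<equiv> 9"
abbreviation (input) fn_length :: nat where "fn_length \<equiv> 10"
abbreviation (input) fn_collect_worker :: nat where "fn_collect_worker \<equiv> 11"
abbreviation (input) fn_collect :: nat where "fn_collect \<equiv> 12"
abbreviation (input) fn_order_row :: nat where "fn_order_row \<equiv> 13"
abbreviation (input) fn_order :: nat where "fn_order \<equiv> 14"
abbreviation (input) fn_heads :: nat where "fn_heads \<equiv> 15"
abbreviation (input) fn_next :: nat where "fn_next \<equiv> 16"
abbreviation (input) fn_enumerate :: nat where "fn_enumerate \<equiv> 17"

abbreviation (input) ETrue :: expr where "ETrue \<equiv> ENode ELeaf ELeaf"
abbreviation (input) ESuc :: "expr \<Rightarrow> expr" where "ESuc \<equiv> ENode ELeaf"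
abbreviation (input) EHd :: "expr \<Rightarrow> expr" where "EHd \<equiv> EFst"
abbreviation (input) ETl :: "expr \<Rightarrow> expr" where "ETl \<equiv> ESnd"

abbreviation (input) EWorkers :: "expr \<Rightarrow> expr" where "EWorkers x \<equiv> EFst (EFst x)"
abbreviation (input) EFirmsA :: "expr \<Rightarrow> expr" where "EFirmsA x \<equiv> ESnd (EFst x)"
abbreviation (input) EFirmsB :: "expr \<Rightarrow> expr" where "EFirmsB x \<equiv> ESnd (ESnd x)"

definition body_eq :: expr where
  "body_eq = (let a = EVar 0; b = EVar 1 in
     EIf a
       (EIf b (EIf (ECall fn_eq [EFst a, EFst b]) (ECall fn_eq [ESnd a, ESnd b]) ELeaf) ELeaf)
       (EIf b ELeaf ETrue))"

definition body_mem :: expr where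
  "body_mem = (let x = EVar 0; xs = EVar 1 in
     EIf xs (EIf (ECall fn_eq [x, EHd xs]) ETrue (ECall fn_mem [x, ETl xs])) ELeaf)"

definition body_nth :: expr where
  "body_nth = (let xs = EVar 0; k = EVar 1 in
     EIf k (ECall fn_nth [ETl xs, ESnd k]) (EHd xs))"

definition body_precedes :: expr where
  "body_precedes = (let xs = EVar 0; a = EVar 1; b = EVar 2 in
     EIf xs
       (EIf (ECall fn_eq [b, EHd xs]) ELeaf
         (EIf (ECall fn_eq [a, EHd xs]) ETrue (ECall fn_precedes [ETl xs, a, b])))
       ELeaf)"

text \<open>The lists \<open>rs\<close> are the remaining preference lists of the workers \<open>v, v + 1, \<dots>\<close>.\<close>

definition body_forbidden :: expr where
  "body_forbidden =
     (let rs = EVar 0; v = EVar 1; f = EVar 2; w = EVar 3; as = EVar 4; bs = EVar 5 in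
     EIf rs
       (EIf (EIf (ECall fn_mem [f, ETl (EHd rs)]) ELeaf
               (EIf (ECall fn_precedes [as, v, w]) ETrue (ECall fn_precedes [bs, v, w])))
         ETrue
         (ECall fn_forbidden [ETl rs, ESuc v, f, w, as, bs]))
       ELeaf)"

text \<open>While \<open>rs\<close> is consumed, \<open>s\<close> keeps the whole state, so all
  workers are tested against the same vector.\<close>

definition body_advance :: expr where
  "body_advance = (let rs = EVar 0; w = EVar 1; s = EVar 2; x = EVar 3; f = EHd (EHd rs) in
     EIf rs
       (ENode
         (EIf (ECall fn_forbidden
                [s, ELeaf, f, w, ECall fn_nth [EFirmsA x, f], ECall fn_nth [EFirmsB x, f]])
           (ETl (EHd rs)) (EHd rs))
         (ECall fn_advance [ETl rs, ESuc w, s, x]))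
       ELeaf)"

text \<open>\<open>ELeaf\<close> encodes the empty list. Its presence in the state means that some
  worker has run out of firms, and then no feasible vector lies above.\<close>

definition body_closure :: expr where
  "body_closure =
     EIf (ECall fn_mem [ELeaf, EVar 0]) ELeaf
       (ELet (ECall fn_advance [EVar 0, ELeaf, EVar 0, EVar 1])
         (let s' = EVar 0; s = EVar 1; x = EVar 2 in
          EIf (ECall fn_eq [s', s]) (ENode ELeaf s) (ECall fn_closure [s', x])))"

text \<open>One function serves three purposes: placing a single entry into the zero vector,
  building raised vectors, and comparing prefixes.\<close>

definition body_splice :: expr where
  "body_splice = (let xs = EVar 0; ys = EVar 1; k = EVar 2; z = EVar 3 in
     EIf k
       (ENode (EHd xs) (ECall fn_splice [ETl xs, ETl ys, ESnd k, z]))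
       (ENode z (ETl ys)))"

text \<open>For positions below \<open>n\<close>, \<open>p ! w \<le> q ! w\<close> holds iff the
  firm that \<open>q\<close> assigns to \<open>w\<close> still occurs in the remaining list of
  \<open>w\<close> under \<open>p\<close>.\<close>

definition body_vec_le :: expr where
  "body_vec_le = (let s = EVar 0; s' = EVar 1 in
     EIf s
       (EIf (ECall fn_mem [EHd (EHd s'), EHd s]) (ECall fn_vec_le [ETl s, ETl s']) ELeaf)
       ETrue)"

definition body_length :: expr where
  "body_length = EIf (EVar 0) (ESuc (ECall fn_length [ETl (EVar 0)])) ELeaf"

text \<open>The remaining list \<open>r\<close> is both the loop counter over the bounds
  \<open>k\<close> and the entry to be spliced in.\<close>

definition body_collect_worker :: expr where
  "body_collect_worker =
     EIf (EVar 2)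
       (ELet (ECall fn_closure
               [ECall fn_splice [EWorkers (EVar 4), EWorkers (EVar 4), EVar 1, EVar 2], EVar 4])
         (let c = EVar 0; gs = EVar 1; w = EVar 2; r = EVar 3; bottom = EVar 4; x = EVar 5 in
          ECall fn_collect_worker
            [EIf c (EIf (ECall fn_mem [ESnd c, ENode bottom gs]) gs (ENode (ESnd c) gs)) gs,
             w, ETl r, bottom, x]))
       (EVar 0)"

definition body_collect :: expr where
  "body_collect = (let gs = EVar 0; w = EVar 1; rs = EVar 2; bottom = EVar 3; x = EVar 4 in
     EIf rs
       (ECall fn_collect
         [ECall fn_collect_worker [gs, w, EHd rs, bottom, x], ESuc w, ETl rs, bottom, x])
       gs)"

definition body_order_row :: expr where
  "body_order_row = (let i = EVar 0; p = EVar 1; qs = EVar 2; j = EVar 3; acc = EVar 4 in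
     EIf qs
       (ECall fn_order_row
         [i, p, ETl qs, ESuc j,
          EIf (ECall fn_vec_le [p, EHd qs]) (ENode (ENode i j) acc) acc])
       acc)"

definition body_order :: expr where
  "body_order = (let ps = EVar 0; i = EVar 1; gs = EVar 2; acc = EVar 3 in
     EIf ps
       (ECall fn_order [ETl ps, ESuc i, gs, ECall fn_order_row [i, EHd ps, gs, ELeaf, acc]])
       acc)"

definition body_heads :: expr where
  "body_heads = EIf (EVar 0) (ENode (EHd (EHd (EVar 0))) (ECall fn_heads [ETl (EVar 0)])) ELeaf"

text \<open>
  The lists \<open>take w p\<close> and \<open>take w q\<close> are compared by overwriting the first \<open>w\<close> entries of \<open>q\<close>
  by those of \<open>p\<close>.
\<close>

definition body_next :: expr where
  "body_next =
     EIf (EVar 1)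
       (ELet (ECall fn_closure
               [ECall fn_splice
                 [EVar 0, EWorkers (EVar 2), ESnd (EVar 1),
                  ETl (ECall fn_nth [EVar 0, ESnd (EVar 1)])],
                EVar 2])
         (let c = EVar 0; s = EVar 1; w = ESnd (EVar 2); x = EVar 3 in
          EIf (EIf c
                (ECall fn_eq [ECall fn_splice [s, ESnd c, w, ECall fn_nth [ESnd c, w]], ESnd c])
                ELeaf)
            c
            (ECall fn_next [s, w, x])))
       ELeaf"

definition body_enumerate :: expr where
  "body_enumerate =
     EIf (EVar 0)
       (ELet (EEmit (ECall fn_heads [ESnd (EVar 0)]))
         (let s = ESnd (EVar 1); x = EVar 2 in
          ECall fn_enumerate [ECall fn_next [s, ECall fn_length [s], x], x]))
       ELeaf"

definition main_order :: expr where
  "main_order =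
     ELet (ECall fn_closure [EWorkers (EVar 0), EVar 0])
       (EIf (EVar 0)
         (ELet (ECall fn_collect [ELeaf, ELeaf, EWorkers (EVar 1), ESnd (EVar 0), EVar 1])
           (ENode (ECall fn_length [EVar 0]) (ECall fn_order [EVar 0, ELeaf, EVar 0, ELeaf])))
         ELeaf)"

definition main_enumerate :: expr where
  "main_enumerate =
     ECall fn_enumerate [ECall fn_closure [EWorkers (EVar 0), EVar 0], EVar 0]"

definition library_functions :: program where
  "library_functions =
     [body_eq, body_mem, body_nth, body_precedes, body_forbidden, body_advance, body_closure,
      body_splice, body_vec_le, body_length, body_collect_worker, body_collect, body_order_row,
      body_order, body_heads, body_next, body_enumerate]"

text \<open>Index \<open>0\<close> stays open for the main function, so that each library call is
  specified once for both programs.\<close>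

abbreviation program_of :: "expr \<Rightarrow> program" where
  "program_of m \<equiv> m # library_functions"

section \<open>Encoded truth values, numbers and lists\<close>

definition enc_bool :: "bool \<Rightarrow> sexp" where
  "enc_bool b = (if b then Node Leaf Leaf else Leaf)"

lemma enc_bool_simps [simp]: "enc_bool True = Node Leaf Leaf" "enc_bool False = Leaf"
  "enc_bool b = Leaf \<longleftrightarrow> \<not> b" "Leaf = enc_bool b \<longleftrightarrow> \<not> b"
  by (auto simp: enc_bool_def)

lemma size_enc_nat [simp]: "size (enc_nat k) = k"
  by (induction k) auto

lemma enc_nat_eq_iff [simp]: "enc_nat a = enc_nat b \<longleftrightarrow> a = b"
proof (induction a arbitrary: b)
  case (Suc a)
  then show ?case by (cases b) auto
qed (metis enc_nat.simps not0_implies_Suc sexp.distinct(1))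

lemma enc_nat_eq_Leaf_iff [simp]: "enc_nat a = Leaf \<longleftrightarrow> a = 0" "Leaf = enc_nat a \<longleftrightarrow> a = 0"
  using enc_nat_eq_iff[of a 0] enc_nat_eq_iff[of 0 a] by auto

lemma enc_list_eq_Leaf_iff [simp]: "enc_list enc xs = Leaf \<longleftrightarrow> xs = []" "Leaf = enc_list enc xs \<longleftrightarrow> xs = []"
  by (cases xs; auto)+

lemma enc_list_eq_iff:
  "inj_on enc (set xs \<union> set ys) \<Longrightarrow> enc_list enc xs = enc_list enc ys \<longleftrightarrow> xs = ys"
proof (induction xs arbitrary: ys)
  case (Cons x xs)
  show ?case
  proof (cases ys)
    case (Cons y ys')
    have "inj_on enc (set xs \<union> set ys')"
      using Cons.prems by (rule inj_on_subset) (auto simp: Cons)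
    from Cons.IH[OF this] show ?thesis
      using Cons.prems by (auto simp: Cons inj_on_def)
  qed simp
qed auto

lemma inj_enc_list: "inj enc \<Longrightarrow> inj (enc_list enc)"
  by (auto intro!: injI dest: enc_list_eq_iff[THEN iffD1, rotated] intro: inj_on_subset)

lemma inj_enc_nat: "inj enc_nat"
  by (rule injI) simp

lemma sexp_fst_enc_list [simp]: "xs \<noteq> [] \<Longrightarrow> sexp_fst (enc_list enc xs) = enc (hd xs)"
  by (cases xs) auto

lemma sexp_snd_enc_list [simp]: "sexp_snd (enc_list enc xs) = enc_list enc (tl xs)"
  by (cases xs) auto

lemma size_enc_list_le:
  "(\<And>x. x \<in> set xs \<Longrightarrow> size (enc x) \<le> k) \<Longrightarrow> size (enc_list enc xs) \<le> length xs * (k + 1)"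
  by (induction xs) (fastforce simp: add_mono)+

lemma precedes_Cons: "precedes (x # xs) a b \<longleftrightarrow> x = a \<and> b \<in> set xs \<or> precedes xs a b" (is "?L = ?R")
proof
  assume ?L
  then obtain i j where ij: "i < j" "j < length (x # xs)" "(x # xs) ! i = a" "(x # xs) ! j = b"
    by (auto simp: precedes_def)
  then obtain j' where j': "j = Suc j'"
    by (cases j) auto
  show ?R
  proof (cases i)
    case (Suc i')
    with ij j' have "precedes xs a b"
      unfolding precedes_def by (intro exI[of _ i'] exI[of _ j']) simp
    then show ?thesis ..
  qed (use ij j' in auto)
next
  assume ?R
  then show ?L
  proof
    assume "x = a \<and> b \<in> set xs"
    then obtain j where "j < length xs" "xs ! j = b" "x = a"
      by (auto simp: in_set_conv_nth)
    then show ?L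
      unfolding precedes_def by (intro exI[of _ 0] exI[of _ "Suc j"]) simp
  next
    assume "precedes xs a b"
    then obtain i j where "i < j" "j < length xs" "xs ! i = a" "xs ! j = b"
      by (auto simp: precedes_def)
    then show ?L
      unfolding precedes_def by (intro exI[of _ "Suc i"] exI[of _ "Suc j"]) simp
  qed
qed

lemma precedes_in_set: "precedes xs a b \<Longrightarrow> b \<in> set xs"
  by (auto simp: precedes_def)

lemmas body_defs = body_eq_def body_mem_def body_nth_def body_precedes_def body_forbidden_def
  body_advance_def body_closure_def body_splice_def body_vec_le_def body_length_def
  body_collect_worker_def body_collect_def body_order_row_def body_order_def body_heads_def
  body_next_def body_enumerate_def Let_def

section \<open>Calls of the elementary functions\<close>

lemma length_library_functions [simp]: "length library_functions = 17"
  by (simp add: library_functions_def)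

lemma program_nth:
  "program_of m ! fn_eq = body_eq" "program_of m ! fn_mem = body_mem" "program_of m ! fn_nth = body_nth"
  "program_of m ! fn_precedes = body_precedes" "program_of m ! fn_forbidden = body_forbidden"
  "program_of m ! fn_advance = body_advance" "program_of m ! fn_closure = body_closure" "program_of m ! fn_splice = body_splice"
  "program_of m ! fn_vec_le = body_vec_le" "program_of m ! fn_length = body_length"
  "program_of m ! fn_collect_worker = body_collect_worker" "program_of m ! fn_collect = body_collect"
  "program_of m ! fn_order_row = body_order_row" "program_of m ! fn_order = body_order" "program_of m ! fn_heads = body_heads"
  "program_of m ! fn_next = body_next" "program_of m ! fn_enumerate = body_enumerate"
  by (simp_all add: library_functions_def)

text \<open>Both trees are descended in parallel until one of them ends, so the size of
  \<open>a\<close> alone bounds the time.\<close>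

lemma eq_returns: "call_returns (program_of m) fn_eq [a, b] (enc_bool (a = b)) (30 * size a + 10)"
proof (induction a arbitrary: b)
  case Leaf
  show ?case
    by (rule call_returnsI[OF _ program_nth(1)]) (auto simp: body_defs)
next
  case (Node a1 a2)
  show ?case
    by (rule call_returnsI[OF _ program_nth(1)], simp, cases b)
      (auto simp: body_defs intro!: wp_callI[OF Node.IH(1)] wp_callI[OF Node.IH(2)])
qed

text \<open>Injectivity is asked for only on the elements at hand, because the encoding of states is
  injective on \<open>vectors\<close> but identifies all positions beyond the end of a list.\<close>

lemma mem_returns:
  "inj_on enc (insert x (set xs)) \<Longrightarrow>
   call_returns (program_of m) fn_mem [enc x, enc_list enc xs] (enc_bool (x \<in> set xs))
     ((length xs + 1) * (30 * size (enc x) + 40))"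
proof (induction xs)
  case Nil
  show ?case
    by (rule call_returnsI[OF _ program_nth(2)]) (auto simp: body_defs)
next
  case (Cons y xs)
  have inj: "inj_on enc (insert x (set xs))" "enc x = enc y \<longleftrightarrow> x = y"
    using Cons.prems by (auto simp: inj_on_def)
  show ?case
    by (rule call_returnsI[OF _ program_nth(2)])
      (auto simp: body_defs inj(2) intro!: wp_callI[OF eq_returns] wp_callI[OF Cons.IH[OF inj(1)]])
qed

lemma nth_returns:
  "k < length xs \<Longrightarrow>
   call_returns (program_of m) fn_nth [enc_list enc xs, enc_nat k] (enc (xs ! k)) (10 * k + 10)"
proof (induction k arbitrary: xs)
  case 0
  then show ?case
    by (intro call_returnsI[OF _ program_nth(3)]) (auto simp: body_defs hd_conv_nth)
next
  case (Suc k)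
  then have "call_returns (program_of m) fn_nth [enc_list enc (tl xs), enc_nat k] (enc (tl xs ! k)) (10 * k + 10)"
    by simp
  note IH = wp_callI[OF this]
  show ?case
    by (rule call_returnsI[OF _ program_nth(3)])
      (use Suc.prems in \<open>auto simp: body_defs nth_tl intro!: IH\<close>)
qed

text \<open>Knowing that \<open>b\<close> occurs lets the program answer true on meeting
  \<open>a\<close> first, without looking further for \<open>b\<close>. Distinctness justifies
  answering false on meeting \<open>b\<close> first.\<close>

lemma precedes_returns:
  "distinct xs \<Longrightarrow> b \<in> set xs \<Longrightarrow>
   call_returns (program_of m) fn_precedes [enc_list enc_nat xs, enc_nat a, enc_nat b]
     (enc_bool (precedes xs a b)) ((length xs + 1) * (30 * a + 30 * b + 60))"
proof (induction xs)
  case (Cons x xs)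
  show ?case
    by (rule call_returnsI[OF _ program_nth(4)])
      (use Cons.prems in \<open>auto simp: body_defs precedes_Cons dest: precedes_in_set
        intro!: wp_callI[OF eq_returns] wp_callI[OF Cons.IH]\<close>)
qed simp

section \<open>Correctness and running times of the functions\<close>

definition cost_mem :: "nat \<Rightarrow> nat" where
  "cost_mem n = (n + 1) * (30 * n + 40)"

definition cost_precedes :: "nat \<Rightarrow> nat" where
  "cost_precedes n = (n + 1) * (60 * n + 60)"

definition cost_forbidden :: "nat \<Rightarrow> nat" where
  "cost_forbidden n = (n + 1) * (cost_mem n + 2 * cost_precedes n + 60)"

definition cost_advance :: "nat \<Rightarrow> nat" where
  "cost_advance n = (n + 1) * (cost_forbidden n + 20 * n + 100)"

text \<open>A state consists of at most \<open>n\<close> lists of at most \<open>n\<close> unary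
  numbers below \<open>n\<close>, with one node per list cell.\<close>

definition state_size :: "nat \<Rightarrow> nat" where
  "state_size n = n * (n * (n + 1) + 1)"

definition cost_round :: "nat \<Rightarrow> nat" where
  "cost_round n = 40 * (n + 1) + cost_advance n + 30 * state_size n + 100"

text \<open>Entries at most \<open>n\<close> bound the potential by \<open>n * n\<close>, so at most
  \<open>n * n\<close> rounds change the vector. One more round detects the fixed point or the
  overflow.\<close>

definition cost_closure :: "nat \<Rightarrow> nat" where
  "cost_closure n = (n * n + 1) * cost_round n"

definition cost_vec_le :: "nat \<Rightarrow> nat" where
  "cost_vec_le n = (n + 1) * (cost_mem n + 40)"

lemma mem_nat_returns:
  assumes "length xs \<le> n" "x \<le> n"
  shows "call_returns (program_of m) fn_mem [enc_nat x, enc_list enc_nat xs]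
    (enc_bool (x \<in> set xs)) (cost_mem n)"
  by (rule call_returns_mono[OF mem_returns])
    (use assms in \<open>auto simp: cost_mem_def inj_on_def intro!: mult_mono simp del: mult_Suc\<close>)

lemma pref_list_precedes_returns:
  assumes "pref_list n xs" "a < n" "b < n"
  shows "call_returns (program_of m) fn_precedes [enc_list enc_nat xs, enc_nat a, enc_nat b]
    (enc_bool (precedes xs a b)) (cost_precedes n)"
  by (rule call_returns_mono[OF precedes_returns])
    (use assms pref_list_length[OF assms(1)] in
      \<open>auto simp: cost_precedes_def pref_list_def intro!: mult_mono simp del: mult_Suc\<close>)

text \<open>Stated for arbitrary remaining lists, so that the induction can drop the front worker
  while the index \<open>v\<close> counts up.\<close>

lemma forbidden_returns:
  assumes as: "pref_list n as" and bs: "pref_list n bs" and "f < n" "w < n"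
  shows "\<forall>r\<in>set rs. length r \<le> n \<Longrightarrow> v + length rs \<le> n \<Longrightarrow>
    call_returns (program_of m) fn_forbidden
      [enc_list (enc_list enc_nat) rs, enc_nat v, enc_nat f, enc_nat w,
       enc_list enc_nat as, enc_list enc_nat bs]
      (enc_bool (\<exists>i<length rs. f \<notin> set (tl (rs ! i)) \<and>
        (precedes as (v + i) w \<or> precedes bs (v + i) w)))
      ((length rs + 1) * (cost_mem n + 2 * cost_precedes n + 60))"
proof (induction rs arbitrary: v)
  case Nil
  show ?case
    by (rule call_returnsI[OF _ program_nth(5)]) (auto simp: body_defs)
next
  case (Cons r rs)
  have "call_returns (program_of m) fn_forbidden
      [enc_list (enc_list enc_nat) rs, Node Leaf (enc_nat v), enc_nat f, enc_nat w,
       enc_list enc_nat as, enc_list enc_nat bs]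
      (enc_bool (\<exists>i<length rs. f \<notin> set (tl (rs ! i)) \<and>
        (precedes as (Suc (v + i)) w \<or> precedes bs (Suc (v + i)) w)))
      ((length rs + 1) * (cost_mem n + 2 * cost_precedes n + 60))"
    using Cons.IH[of "Suc v"] Cons.prems by simp
  note IH = wp_callI[OF this]
  have "length (tl r) \<le> n" "f \<le> n" "v < n"
    using Cons.prems assms by auto
  note calls = wp_callI[OF mem_nat_returns[OF this(1,2)]]
    wp_callI[OF pref_list_precedes_returns[OF as this(3) \<open>w < n\<close>]]
    wp_callI[OF pref_list_precedes_returns[OF bs this(3) \<open>w < n\<close>]]
  show ?case
    by (rule call_returnsI[OF _ program_nth(5)])
      (auto simp: body_defs Ex_less_Suc2 intro!: IH calls)
qed

lemma splice_returns:
  "k < length xs \<Longrightarrow> k < length ys \<Longrightarrow>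
   call_returns (program_of m) fn_splice [enc_list enc xs, enc_list enc ys, enc_nat k, enc z]
     (enc_list enc (take k xs @ z # drop (Suc k) ys)) (20 * k + 20)"
proof (induction k arbitrary: xs ys)
  case 0
  then show ?case
    by (intro call_returnsI[OF _ program_nth(8)]) (auto simp: body_defs drop_Suc)
next
  case (Suc k)
  then obtain x xs' y ys' where xs: "xs = x # xs'" "ys = y # ys'"
    by (metis Suc_length_conv Suc_less_eq2)
  have IH: "call_returns (program_of m) fn_splice
    [enc_list enc xs', enc_list enc ys', enc_nat k, enc z]
     (enc_list enc (take k xs' @ z # drop (Suc k) ys')) (20 * k + 20)"
    using Suc xs by simp
  show ?case
    unfolding xs by (rule call_returnsI[OF _ program_nth(8)])
      (auto simp: body_defs intro!: wp_callI[OF IH])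
qed

lemma length_returns:
  "call_returns (program_of m) fn_length [enc_list enc xs] (enc_nat (length xs))
     (20 * length xs + 20)"
proof (induction xs)
  case Nil
  show ?case
    by (rule call_returnsI[OF _ program_nth(10)]) (auto simp: body_defs)
next
  case (Cons x xs)
  show ?case
    by (rule call_returnsI[OF _ program_nth(10)]) (auto simp: body_defs intro!: wp_callI[OF Cons.IH])
qed

lemma heads_returns:
  "[] \<notin> set xss \<Longrightarrow>
   call_returns (program_of m) fn_heads [enc_list (enc_list enc) xss] (enc_list enc (map hd xss))
     (20 * length xss + 20)"
proof (induction xss)
  case Nil
  show ?case
    by (rule call_returnsI[OF _ program_nth(15)]) (auto simp: body_defs)
next
  case (Cons xs xss)
  then have IH: "call_returns (program_of m) fn_heads [enc_list (enc_list enc) xss]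
     (enc_list enc (map hd xss)) (20 * length xss + 20)"
    by simp
  show ?case
    by (rule call_returnsI[OF _ program_nth(15)])
      (use Cons.prems in \<open>auto simp: body_defs intro!: wp_callI[OF IH]\<close>)
qed

primrec enc_option :: "('a \<Rightarrow> sexp) \<Rightarrow> 'a option \<Rightarrow> sexp" where
  "enc_option enc None = Leaf"
| "enc_option enc (Some x) = Node Leaf (enc x)"

section \<open>States of the programs and least-vector computations\<close>

context common_instances
begin

definition suffixes :: "nat list \<Rightarrow> nat list list" where
  "suffixes p = map (\<lambda>w. drop (p ! w) (W ! w)) [0..<n]"

definition enc_state :: "nat list \<Rightarrow> sexp" where
  "enc_state p = enc_list (enc_list enc_nat) (suffixes p)"

definition vectors :: "nat list set" where
  "vectors = {p. length p = n \<and> (\<forall>w<n. p ! w \<le> n)}"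

lemma length_suffixes [simp]: "length (suffixes p) = n"
  by (simp add: suffixes_def)

lemma suffixes_nth: "w < n \<Longrightarrow> suffixes p ! w = drop (p ! w) (W ! w)"
  by (simp add: suffixes_def)

lemma suffixes_inj:
  assumes "p \<in> vectors" "q \<in> vectors" "suffixes p = suffixes q"
  shows "p = q"
proof (rule nth_equalityI)
  fix w
  assume "w < length p"
  then have w: "w < n" "p ! w \<le> n" "q ! w \<le> n"
    using assms by (auto simp: vectors_def)
  then have "length (drop (p ! w) (W ! w)) = length (drop (q ! w) (W ! w))"
    using assms(3) by (metis suffixes_nth)
  then show "p ! w = q ! w"
    using w W_props(2)[of w] by simp
qed (use assms in \<open>auto simp: vectors_def\<close>)

lemma enc_state_inj: "inj_on enc_state vectors"
  using suffixes_inj enc_list_eq_iff[OF inj_on_subset[OF inj_enc_list[OF inj_enc_nat] subset_UNIV]]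
  by (auto simp: enc_state_def inj_on_def)

lemma enc_state_eq_iff: "p \<in> vectors \<Longrightarrow> q \<in> vectors \<Longrightarrow> enc_state p = enc_state q \<longleftrightarrow> p = q"
  using enc_state_inj by (auto dest: inj_onD)

lemma size_enc_state: "size (enc_state p) \<le> state_size n"
proof -
  have "size (enc_list enc_nat xs) \<le> n * (n + 1)" if xs: "xs \<in> set (suffixes p)" for xs
  proof -
    obtain w where w: "w < n" "xs = drop (p ! w) (W ! w)"
      using xs by (auto simp: suffixes_def)
    then have "length xs \<le> n" "set xs \<subseteq> {..<n}"
      using W_props(2,4)[of w] set_drop_subset[of "p ! w" "W ! w"] by auto
    then have "size (enc_list enc_nat xs) \<le> length xs * (n + 1)"
      by (intro size_enc_list_le) auto
    also have "\<dots> \<le> n * (n + 1)"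
      using \<open>length xs \<le> n\<close> by (rule mult_right_mono) simp
    finally show ?thesis .
  qed
  from size_enc_list_le[of "suffixes p" "enc_list enc_nat", OF this] show ?thesis
    by (simp add: enc_state_def state_size_def)
qed

lemma state_eq_returns:
  assumes "p \<in> vectors" "q \<in> vectors"
  shows "call_returns (program_of m) fn_eq [enc_state p, enc_state q] (enc_bool (p = q))
    (30 * state_size n + 10)"
  using call_returns_mono[OF eq_returns[of m "enc_state p" "enc_state q"]] size_enc_state[of p]
  by (simp add: enc_state_eq_iff[OF assms])

text \<open>The worker lists of the input are thus already the state of the zero vector. They serve
  as the starting point of the closure and as the supply of zero entries for splicing.\<close>

lemma suffixes_zero: "suffixes (replicate n 0) = W"
  using W_props(1) by (auto simp: suffixes_def intro: nth_equalityI)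

lemma enc_input_simps:
  "sexp_fst (sexp_fst (enc_input A B)) = enc_state (replicate n 0)"
  "sexp_snd (sexp_fst (enc_input A B)) = enc_list (enc_list enc_nat) (firm_prefs A)"
  "sexp_snd (sexp_snd (enc_input A B)) = enc_list (enc_list enc_nat) (firm_prefs B)"
  by (simp_all add: enc_input_def enc_instance_def enc_state_def suffixes_zero)

lemma firm_pref_list: "I \<in> {A, B} \<Longrightarrow> f < n \<Longrightarrow> pref_list n (firm_prefs I ! f)"
  using firm_list_props[of I] by (simp add: pref_list_def)

lemma drop_suffixes:
  assumes "w < n" "p ! w < n"
  shows "drop w (suffixes p) =
    (assigned p w # drop (Suc (p ! w)) (W ! w)) # drop (Suc w) (suffixes p)"
proof -
  have "drop (p ! w) (W ! w) = assigned p w # drop (Suc (p ! w)) (W ! w)"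
    using assms W_props(2)[of w] by (simp add: assigned_def Cons_nth_drop_Suc)
  then show ?thesis
    using Cons_nth_drop_Suc[of w "suffixes p"] assms by (simp add: suffixes_nth)
qed

lemma drop_suffixes_advance:
  assumes "w < n" "p ! w < n"
  shows "drop w (suffixes (advance p)) =
    (if forbidden p w then drop (Suc (p ! w)) (W ! w)
     else assigned p w # drop (Suc (p ! w)) (W ! w)) # drop (Suc w) (suffixes (advance p))"
proof -
  have "drop (p ! w) (W ! w) = assigned p w # drop (Suc (p ! w)) (W ! w)"
    using assms W_props(2)[of w] by (simp add: assigned_def Cons_nth_drop_Suc)
  moreover have "advance p ! w = (if forbidden p w then Suc (p ! w) else p ! w)"
    using assms(1) by (simp add: advance_def)
  ultimately show ?thesis
    using assms(1) by (subst Cons_nth_drop_Suc[symmetric]) (simp_all add: suffixes_nth)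
qed

lemma state_forbidden_returns:
  assumes "length p = n" "w < n" "p ! w < n"
  shows "call_returns (program_of m) fn_forbidden
      [enc_state p, Leaf, enc_nat (assigned p w), enc_nat w,
       enc_list enc_nat (firm_prefs A ! assigned p w), enc_list enc_nat (firm_prefs B ! assigned p w)]
      (enc_bool (forbidden p w)) (cost_forbidden n)"
proof -
  have f: "assigned p w < n"
    using assms W_nth_less by (simp add: assigned_def)
  have "\<forall>r\<in>set (suffixes p). length r \<le> n"
    using W_props(2) by (auto simp: suffixes_def)
  moreover have "pref_list n (firm_prefs A ! assigned p w)" "pref_list n (firm_prefs B ! assigned p w)"
    using f by (auto intro: firm_pref_list)
  ultimately have *: "call_returns (program_of m) fn_forbidden
      [enc_state p, Leaf, enc_nat (assigned p w), enc_nat w,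
       enc_list enc_nat (firm_prefs A ! assigned p w), enc_list enc_nat (firm_prefs B ! assigned p w)]
      (enc_bool (\<exists>i<n. assigned p w \<notin> set (tl (suffixes p ! i)) \<and>
        (precedes (firm_prefs A ! assigned p w) i w \<or> precedes (firm_prefs B ! assigned p w) i w)))
      (cost_forbidden n)"
    using forbidden_returns[where rs = "suffixes p" and v = 0] f assms(2)
    by (fastforce simp: enc_state_def cost_forbidden_def)
  have "(\<exists>i<n. assigned p w \<notin> set (tl (suffixes p ! i)) \<and>
      (precedes (firm_prefs A ! assigned p w) i w \<or> precedes (firm_prefs B ! assigned p w) i w))
    \<longleftrightarrow> forbidden p w"
    by (auto simp: forbidden_def prefers_either_def firm_prefers_def suffixes_nth drop_Suc tl_drop)
  with * show ?thesis
    by simp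
qed

text \<open>Positions below \<open>n\<close> leave every list nonempty, so its head is the assigned
  firm. The induction goes down from \<open>w = n\<close>, as the program consumes the lists from
  the front.\<close>

lemma advance_returns:
  assumes p: "length p = n" "\<forall>w<n. p ! w < n"
  shows "w \<le> n \<Longrightarrow> call_returns (program_of m) fn_advance
      [enc_list (enc_list enc_nat) (drop w (suffixes p)), enc_nat w, enc_state p, enc_input A B]
      (enc_list (enc_list enc_nat) (drop w (suffixes (advance p))))
      ((n - w + 1) * (cost_forbidden n + 20 * n + 100))"
proof (induction rule: inc_induct)
  case base
  show ?case
    by (rule call_returnsI[OF _ program_nth(6)]) (auto simp: body_defs)
next
  case (step w)
  have w: "w < n" "p ! w < n"
    using step p by auto
  have f: "assigned p w < n"
    using w W_nth_less by (simp add: assigned_def)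
  have IH: "call_returns (program_of m) fn_advance
      [enc_list (enc_list enc_nat) (drop (Suc w) (suffixes p)), Node Leaf (enc_nat w), enc_state p,
       enc_input A B]
      (enc_list (enc_list enc_nat) (drop (Suc w) (suffixes (advance p))))
      ((n - w) * (cost_forbidden n + 20 * n + 100))"
    using step.IH w by (simp add: Suc_diff_Suc)
  have nth: "call_returns (program_of m) fn_nth
      [enc_list (enc_list enc_nat) (firm_prefs I), enc_nat (assigned p w)]
      (enc_list enc_nat (firm_prefs I ! assigned p w)) (10 * n + 10)" if "I \<in> {A, B}" for I
    using f firm_list_props(1)[OF that] by (intro call_returns_mono[OF nth_returns]) auto
  show ?case
    unfolding drop_suffixes[OF w] drop_suffixes_advance[OF w]
    by (rule call_returnsI[OF _ program_nth(6)])
      (auto simp: body_defs enc_input_simps intro!: wp_callI[OF nth[of A]] wp_callI[OF nth[of B]]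
        wp_callI[OF state_forbidden_returns[OF p(1) w]] wp_callI[OF IH])
qed

lemma Nil_in_suffixes_iff:
  assumes "p \<in> vectors"
  shows "[] \<in> set (suffixes p) \<longleftrightarrow> (\<exists>w<n. p ! w = n)"
  using assms W_props(2) by (force simp: suffixes_def vectors_def intro: antisym)

text \<open>The factor counts the rounds that the potential still allows, plus a final one. A round
  that changes \<open>p\<close> raises the sum and thereby pays for itself.\<close>

lemma closure_returns_aux:
  "p \<in> vectors \<Longrightarrow> call_returns (program_of m) fn_closure [enc_state p, enc_input A B]
     (enc_option enc_state (closure p)) ((n * n + 1 - sum_list p) * cost_round n)"
proof (induction "n * n - sum_list p" arbitrary: p rule: less_induct)
  case less
  have len: "length p = n" and le: "\<forall>w<n. p ! w \<le> n"
    using less.prems by (auto simp: vectors_def)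
  have sum: "sum_list p \<le> n * n"
    by (rule sum_list_le[OF len le])
  \<comment> \<open>The summand \<open>1\<close> keeps the budget positive even at the largest
    possible sum, where the last round still has to be paid.\<close>
  then have at_least_once: "cost_round n \<le> (n * n + 1 - sum_list p) * cost_round n"
    by (simp add: Suc_diff_le)
  have "inj_on (enc_list enc_nat) (insert [] (set (suffixes p)))"
    using inj_enc_list[OF inj_enc_nat] by (rule inj_on_subset) simp
  from mem_returns[OF this, of m]
  have mem: "call_returns (program_of m) fn_mem [Leaf, enc_state p]
      (enc_bool (\<exists>w<n. p ! w = n)) (40 * (n + 1))"
    by (simp add: enc_state_def Nil_in_suffixes_iff[OF less.prems] mult.commute)
  show ?case
  proof (cases "\<exists>w<n. p ! w = n")
    case True
    then have "closure p = None"
      using closure_overflow[OF len] by auto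
    moreover have "call_returns (program_of m) fn_closure [enc_state p, enc_input A B] Leaf
        (cost_round n)"
      using True by (intro call_returnsI[OF _ program_nth(7)])
        (auto simp: body_defs cost_round_def intro!: wp_callI[OF mem])
    ultimately show ?thesis
      using at_least_once by (auto intro: call_returns_mono)
  next
    case False
    then have less_n: "\<forall>w<n. p ! w < n"
      using le by (auto intro: le_neq_implies_less)
    have adv: "call_returns (program_of m) fn_advance [enc_state p, Leaf, enc_state p, enc_input A B]
        (enc_state (advance p)) (cost_advance n)"
      using advance_returns[OF len less_n, of 0] by (simp add: enc_state_def cost_advance_def)
    have adv_vec: "advance p \<in> vectors"
      using less_n by (auto simp: vectors_def advance_def Suc_le_eq)
    note eq = state_eq_returns[OF adv_vec less.prems, of m]
    show ?thesis
    proof (cases "advance p = p")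
      case True
      have "call_returns (program_of m) fn_closure [enc_state p, enc_input A B]
          (Node Leaf (enc_state p)) (cost_round n)"
        using \<open>\<not> (\<exists>w<n. p ! w = n)\<close> True
        by (intro call_returnsI[OF _ program_nth(7)])
          (auto simp: body_defs cost_round_def intro!: wp_callI[OF mem] wp_callI[OF adv] wp_callI[OF eq])
      then show ?thesis
        using at_least_once by (auto simp: closure_fixed[OF len less_n True] intro: call_returns_mono)
    next
      case neq: False
      have sum_less: "sum_list p < sum_list (advance p)"
        by (rule sum_list_advance_less[OF len neq])
      have sum': "sum_list (advance p) \<le> n * n"
        using sum_list_le[OF length_advance] adv_vec by (auto simp: vectors_def)
      have "n * n - sum_list (advance p) < n * n - sum_list p"
        using sum_less sum' by linarith
      note IH = less.hyps[OF this adv_vec, unfolded closure_advance[OF len]]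
      have "(n * n + 1 - sum_list (advance p) + 1) * cost_round n
          \<le> (n * n + 1 - sum_list p) * cost_round n"
        using sum_less sum' by (intro mult_right_mono) auto
      then have cost: "(n * n + 1 - sum_list (advance p)) * cost_round n + cost_round n
          \<le> (n * n + 1 - sum_list p) * cost_round n"
        by (simp add: algebra_simps)
      show ?thesis
        using \<open>\<not> (\<exists>w<n. p ! w = n)\<close> neq cost
        by (intro call_returnsI[OF _ program_nth(7)])
          (auto simp: body_defs cost_round_def intro!: wp_callI[OF mem] wp_callI[OF adv]
            wp_callI[OF eq] wp_callI[OF IH])
    qed
  qed
qed

lemma closure_returns:
  assumes "p \<in> vectors"
  shows "call_returns (program_of m) fn_closure [enc_state p, enc_input A B]
    (enc_option enc_state (closure p)) (cost_closure n)"
  by (rule call_returns_mono[OF closure_returns_aux[OF assms]])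
    (simp only: cost_closure_def, rule mult_le_mono1, simp)

lemma feasible_subset_vectors: "feasible \<subseteq> vectors"
  by (auto simp: feasible_def vectors_def)

lemma splice_suffixes:
  assumes "length p = n" "length q = n" "w < n"
  shows "take w (suffixes p) @ drop k (W ! w) # drop (Suc w) (suffixes q) =
    suffixes (take w p @ k # drop (Suc w) q)"
  using assms by (intro nth_equalityI) (auto simp: suffixes_nth nth_append nth_Cons')

lemma state_splice_returns:
  assumes "length p = n" "length q = n" "w < n" "r = enc_list enc_nat (drop k (W ! w))"
  shows "call_returns (program_of m) fn_splice [enc_state p, enc_state q, enc_nat w, r]
    (enc_state (take w p @ k # drop (Suc w) q)) (20 * n + 20)"
  using call_returns_mono[OF splice_returns[of w "suffixes p" "suffixes q" m "enc_list enc_nat"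
        "drop k (W ! w)"], of "20 * n + 20"] assms
  by (simp add: enc_state_def splice_suffixes)

lemma vec_le_returns_aux:
  assumes p: "p \<in> feasible" and q: "q \<in> feasible"
  shows "w \<le> n \<Longrightarrow> call_returns (program_of m) fn_vec_le
      [enc_list (enc_list enc_nat) (drop w (suffixes p)),
       enc_list (enc_list enc_nat) (drop w (suffixes q))]
      (enc_bool (\<forall>i<n. w \<le> i \<longrightarrow> p ! i \<le> q ! i)) ((n - w + 1) * (cost_mem n + 40))"
proof (induction rule: inc_induct)
  case base
  show ?case
    by (rule call_returnsI[OF _ program_nth(9)]) (auto simp: body_defs)
next
  case (step w)
  have w: "w < n" "p ! w < n" "q ! w < n"
    using step p q feasibleD(2) by auto
  have IH: "call_returns (program_of m) fn_vec_le
      [enc_list (enc_list enc_nat) (drop (Suc w) (suffixes p)),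
       enc_list (enc_list enc_nat) (drop (Suc w) (suffixes q))]
      (enc_bool (\<forall>i<n. Suc w \<le> i \<longrightarrow> p ! i \<le> q ! i)) ((n - w) * (cost_mem n + 40))"
    using step.IH w by (simp add: Suc_diff_Suc)
  have "length (drop (p ! w) (W ! w)) \<le> n" "assigned q w \<le> n"
    using W_props(2)[OF w(1)] feasibleD(4)[OF q w(1)] by auto
  moreover have "assigned q w \<in> set (drop (p ! w) (W ! w)) \<longleftrightarrow> p ! w \<le> q ! w"
    using w by (simp add: assigned_def nth_in_drop_iff)
  moreover have "drop (p ! w) (W ! w) = assigned p w # drop (Suc (p ! w)) (W ! w)"
    using w W_props(2)[of w] by (simp add: assigned_def Cons_nth_drop_Suc)
  ultimately have mem: "call_returns (program_of m) fn_mem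
     [enc_nat (assigned q w),
      Node (enc_nat (assigned p w)) (enc_list enc_nat (drop (Suc (p ! w)) (W ! w)))]
     (enc_bool (p ! w \<le> q ! w)) (cost_mem n)"
    using mem_nat_returns[of "drop (p ! w) (W ! w)" n "assigned q w" m] by simp
  have "(\<forall>i<n. w \<le> i \<longrightarrow> p ! i \<le> q ! i) \<longleftrightarrow> p ! w \<le> q ! w \<and> (\<forall>i<n. Suc w \<le> i \<longrightarrow> p ! i \<le> q ! i)"
    using w(1) by (metis Suc_leD le_eq_less_or_eq Suc_leI order_refl)
  then show ?case
    unfolding drop_suffixes[OF w(1,2)] drop_suffixes[OF w(1,3)]
    by (intro call_returnsI[OF _ program_nth(9)])
      (auto simp: body_defs intro!: wp_callI[OF mem] wp_callI[OF IH])
qed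

lemma vec_le_returns:
  assumes "p \<in> feasible" "q \<in> feasible"
  shows "call_returns (program_of m) fn_vec_le [enc_state p, enc_state q]
    (enc_bool (p \<sqsubseteq> q)) (cost_vec_le n)"
proof -
  have "p \<sqsubseteq> q \<longleftrightarrow> (\<forall>i<n. p ! i \<le> q ! i)"
    using assms feasibleD(1) by (simp add: list_all2_conv_all_nth)
  then show ?thesis
    using vec_le_returns_aux[OF assms, of 0 m] by (simp add: enc_state_def cost_vec_le_def)
qed

end

section \<open>Generators, their order and the successor search\<close>

definition cost_candidate :: "nat \<Rightarrow> nat" where
  "cost_candidate n = cost_closure n + 20 * n + (n * n + 2) * (30 * state_size n + 40) + 100"

definition cost_collect :: "nat \<Rightarrow> nat" where
  "cost_collect n = (n + 1) * ((n + 1) * cost_candidate n + 40)"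

definition cost_next :: "nat \<Rightarrow> nat" where
  "cost_next n = (n + 1) * (cost_closure n + 60 * n + 30 * state_size n + 200)"

abbreviation enc_pairs :: "(nat \<times> nat) list \<Rightarrow> sexp" where
  "enc_pairs \<equiv> enc_list (enc_pair enc_nat enc_nat)"

text \<open>The test rejects \<open>b\<close>, which will be the bottom, and repeated vectors. A
  vector listed at two indices would violate antisymmetry of the order on indices.\<close>

definition add_new :: "'a \<Rightarrow> 'a option \<Rightarrow> 'a list \<Rightarrow> 'a list" where
  "add_new b c gs =
     (case c of None \<Rightarrow> gs | Some g \<Rightarrow> if g \<in> set (b # gs) then gs else g # gs)"

lemma length_fold_add_new: "length (fold (add_new b) cs gs) \<le> length gs + length cs"
proof (induction cs arbitrary: gs)
  case (Cons c cs)
  have "length (add_new b c gs) \<le> length gs + 1"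
    by (simp add: add_new_def split: option.split)
  with Cons.IH[of "add_new b c gs"] show ?case
    by simp
qed simp

lemma set_fold_add_new:
  "b \<notin> set gs \<Longrightarrow> set (fold (add_new b) cs gs) = set gs \<union> ({g. Some g \<in> set cs} - {b})"
proof (induction cs arbitrary: gs)
  case (Cons c cs)
  have "b \<notin> set (add_new b c gs)"
    using Cons.prems by (auto simp: add_new_def split: option.split)
  from Cons.IH[OF this] show ?case
    by (auto simp: add_new_def split: option.splits)
qed simp

lemma distinct_fold_add_new: "distinct gs \<Longrightarrow> distinct (fold (add_new b) cs gs)"
proof (induction cs arbitrary: gs)
  case (Cons c cs)
  then show ?case
    by (auto simp: add_new_def split: option.split)
qed simp

context common_instances
begin

definition candidate :: "nat \<Rightarrow> nat \<Rightarrow> nat list option" where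
  "candidate w k = closure ((replicate n 0)[w := k])"

definition generators :: "nat list \<Rightarrow> nat list list" where
  "generators bottom =
     fold (add_new bottom) (concat (map (\<lambda>w. map (candidate w) [0..<n]) [0..<n])) []"

text \<open>Reversed, because the program pushes the pairs onto an accumulator.\<close>

definition order_row :: "nat list list \<Rightarrow> nat \<Rightarrow> nat \<Rightarrow> (nat \<times> nat) list" where
  "order_row gs i j = rev (map (Pair i) (filter (\<lambda>j. gs ! i \<sqsubseteq> gs ! j) [j..<length gs]))"

definition order_pairs :: "nat list list \<Rightarrow> nat \<Rightarrow> (nat \<times> nat) list" where
  "order_pairs gs i = concat (rev (map (\<lambda>i. order_row gs i 0) [i..<length gs]))"

lemma set_order_pairs:
  "set (order_pairs gs 0) = {(i, j). i < length gs \<and> j < length gs \<and> gs ! i \<sqsubseteq> gs ! j}"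
  by (auto simp: order_pairs_def order_row_def)

lemma length_order_pairs: "length (order_pairs gs 0) \<le> length gs * length gs"
proof -
  have "length (order_row gs i 0) \<le> length gs" for i
    using length_filter_le[of "\<lambda>j. gs ! i \<sqsubseteq> gs ! j" "[0..<length gs]"] by (simp add: order_row_def)
  then have "length (concat (rev (map (\<lambda>i. order_row gs i 0) is))) \<le> length is * length gs" for "is"
    by (induction "is") (auto simp: add_mono add.commute)
  from this[of "[0..<length gs]"] show ?thesis
    by (simp add: order_pairs_def)
qed

lemma set_generators: "set (generators bottom) = {g. \<exists>w<n. \<exists>k<n. candidate w k = Some g} - {bottom}"
proof -
  have "Some g \<in> set (concat (map (\<lambda>w. map (candidate w) [0..<n]) [0..<n])) \<longleftrightarrow>
      (\<exists>w<n. \<exists>k<n. Some g = candidate w k)" for g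
    by fastforce
  then have "Some g \<in> set (concat (map (\<lambda>w. map (candidate w) [0..<n]) [0..<n])) \<longleftrightarrow>
      (\<exists>w<n. \<exists>k<n. candidate w k = Some g)" for g
    by metis
  then show ?thesis
    by (simp add: generators_def set_fold_add_new)
qed

lemma distinct_generators: "distinct (generators bottom)"
  by (simp add: generators_def distinct_fold_add_new)

lemma length_generators: "length (generators bottom) \<le> n * n"
  using length_fold_add_new[of bottom "concat (map (\<lambda>w. map (candidate w) [0..<n]) [0..<n])" "[]"]
  by (simp add: generators_def length_concat comp_def sum_list_triv)

lemma generators_feasible: "set (generators bottom) \<subseteq> feasible"
  using closure_SomeD(1) by (auto simp: set_generators candidate_def)

lemma birkhoff_order_generators:
  assumes "closure (replicate n 0) = Some bottom"
  shows "birkhoff_order n A (stable_matchings n A \<inter> stable_matchings n B)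
    {..<length (generators bottom)} (set (order_pairs (generators bottom) 0))"
  unfolding set_order_pairs
  by (rule birkhoff_order_common[OF assms distinct_generators])
    (simp add: set_generators candidate_def)

lemma feasible_imp_vector: "p \<in> feasible \<Longrightarrow> p \<in> vectors"
  using feasible_subset_vectors by blast

lemma state_mem_returns:
  assumes "p \<in> feasible" "set gs \<subseteq> feasible" "length gs \<le> k"
  shows "call_returns (program_of m) fn_mem [enc_state p, enc_list enc_state gs]
    (enc_bool (p \<in> set gs)) ((k + 1) * (30 * state_size n + 40))"
proof (rule call_returns_mono[OF mem_returns])
  show "inj_on enc_state (insert p (set gs))"
    by (rule inj_on_subset[OF enc_state_inj]) (use assms feasible_subset_vectors in auto)
  show "(length gs + 1) * (30 * size (enc_state p) + 40) \<le> (k + 1) * (30 * state_size n + 40)"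
    using assms(3) size_enc_state[of p] by (intro mult_mono) auto
qed

lemma zero_vector: "replicate n 0 \<in> vectors"
  by (simp add: vectors_def)

lemma closure_feasible: "closure p = Some q \<Longrightarrow> q \<in> feasible"
  by (rule closure_SomeD)

lemma add_new_candidate_feasible: "set gs \<subseteq> feasible \<Longrightarrow> set (add_new b (candidate w k) gs) \<subseteq> feasible"
  using closure_feasible by (auto simp: add_new_def candidate_def split: option.splits)

lemma fold_add_new_candidate_feasible:
  "set gs \<subseteq> feasible \<Longrightarrow> set (fold (add_new b) (map (candidate w) ks) gs) \<subseteq> feasible"
  by (induction ks arbitrary: gs) (simp_all add: add_new_candidate_feasible)

text \<open>The bound on \<open>length gs + (n - k)\<close> leaves room for one generator per
  remaining candidate. It keeps each membership test, with \<open>bottom\<close> included, to at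
  most \<open>n * n + 1\<close> entries.\<close>

lemma collect_worker_returns:
  assumes w: "w < n" and bottom: "bottom \<in> feasible"
  shows "k \<le> n \<Longrightarrow> set gs \<subseteq> feasible \<Longrightarrow> length gs + (n - k) \<le> n * n \<Longrightarrow>
    call_returns (program_of m) fn_collect_worker
      [enc_list enc_state gs, enc_nat w, enc_list enc_nat (drop k (W ! w)), enc_state bottom,
       enc_input A B]
      (enc_list enc_state (fold (add_new bottom) (map (candidate w) [k..<n]) gs))
      ((n - k + 1) * cost_candidate n)"
proof (induction arbitrary: gs rule: inc_induct)
  case base
  show ?case
    by (rule call_returnsI[OF _ program_nth(11)])
      (use W_props(2)[OF w] in \<open>auto simp: body_defs cost_candidate_def\<close>)
next
  case (step k)
  have drop: "drop k (W ! w) = W ! w ! k # drop (Suc k) (W ! w)"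
    using step.hyps W_props(2)[OF w] by (simp add: Cons_nth_drop_Suc)
  have upd: "take w (replicate n 0) @ k # drop (Suc w) (replicate n 0) = (replicate n 0)[w := k]"
    using w by (simp add: upd_conv_take_nth_drop)
  have splice: "call_returns (program_of m) fn_splice
      [enc_state (replicate n 0), enc_state (replicate n 0), enc_nat w,
       Node (enc_nat (W ! w ! k)) (enc_list enc_nat (drop (Suc k) (W ! w)))]
      (enc_state ((replicate n 0)[w := k])) (20 * n + 20)"
    using state_splice_returns[of "replicate n 0" "replicate n 0" w _ k m, OF _ _ w refl]
    unfolding upd by (simp add: drop)
  have "(replicate n 0)[w := k] \<in> vectors"
    using step.hyps w by (auto simp: vectors_def nth_list_update)
  from closure_returns[OF this, of m]
  have clos: "call_returns (program_of m) fn_closure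
      [enc_state ((replicate n 0)[w := k]), enc_input A B]
      (enc_option enc_state (candidate w k)) (cost_closure n)"
    by (simp add: candidate_def)
  define gs' where "gs' = add_new bottom (candidate w k) gs"
  have "length gs' \<le> length gs + 1"
    by (simp add: gs'_def add_new_def split: option.split)
  then have "length gs' + (n - Suc k) \<le> n * n"
    using step.prems(2) step.hyps by linarith
  from step.IH[OF add_new_candidate_feasible[OF step.prems(1)] this[unfolded gs'_def]]
  have IH: "call_returns (program_of m) fn_collect_worker
      [enc_list enc_state gs', enc_nat w, enc_list enc_nat (drop (Suc k) (W ! w)), enc_state bottom,
       enc_input A B]
      (enc_list enc_state (fold (add_new bottom) (map (candidate w) [k..<n]) gs))
      ((n - k) * cost_candidate n)"
    using step.hyps by (simp add: Suc_diff_Suc gs'_def upt_conv_Cons)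
  have mem: "call_returns (program_of m) fn_mem
      [enc_state q, Node (enc_state bottom) (enc_list enc_state gs)]
      (enc_bool (q = bottom \<or> q \<in> set gs)) ((n * n + 2) * (30 * state_size n + 40))"
    if "q \<in> feasible" for q
    using state_mem_returns[OF that, of "bottom # gs" "n * n + 1" m] step.prems bottom by simp
  show ?case
  proof (cases "candidate w k")
    case None
    then have "gs' = gs"
      by (simp add: gs'_def add_new_def)
    note IH = IH[unfolded this]
    show ?thesis
      unfolding drop using None
      by (intro call_returnsI[OF _ program_nth(11)])
        (auto simp: body_defs enc_input_simps cost_candidate_def[of n] intro!: wp_callI[OF splice]
          wp_callI[OF clos] wp_callI[OF IH])
  next
    case (Some q)
    then have "q \<in> feasible"
      by (auto simp: candidate_def intro: closure_feasible)
    note mem = mem[OF this]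
    have gs': "gs' = (if q = bottom \<or> q \<in> set gs then gs else q # gs)"
      by (simp add: gs'_def add_new_def Some)
    show ?thesis
    proof (cases "q = bottom \<or> q \<in> set gs")
      case True
      with gs' have "gs' = gs"
        by simp
      note IH = IH[unfolded this]
      note mem = mem[unfolded Eq_TrueI[OF True]]
      show ?thesis
        unfolding drop using Some
        by (intro call_returnsI[OF _ program_nth(11)])
          (auto simp: body_defs enc_input_simps cost_candidate_def[of n] intro!: wp_callI[OF splice]
            wp_callI[OF clos] wp_callI[OF IH] wp_callI[OF mem])
    next
      case False
      with gs' have "enc_list enc_state gs' = Node (enc_state q) (enc_list enc_state gs)"
        by simp
      note IH = IH[unfolded this]
      note mem = mem[unfolded Eq_FalseI[OF False]]
      show ?thesis
        unfolding drop using Some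
        by (intro call_returnsI[OF _ program_nth(11)])
          (auto simp: body_defs enc_input_simps cost_candidate_def[of n] intro!: wp_callI[OF splice]
            wp_callI[OF clos] wp_callI[OF IH] wp_callI[OF mem])
    qed
  qed
qed

lemma collect_returns_aux:
  assumes bottom: "bottom \<in> feasible"
  shows "w \<le> n \<Longrightarrow> set gs \<subseteq> feasible \<Longrightarrow> length gs + (n - w) * n \<le> n * n \<Longrightarrow>
    call_returns (program_of m) fn_collect
      [enc_list enc_state gs, enc_nat w, enc_list (enc_list enc_nat) (drop w W), enc_state bottom,
       enc_input A B]
      (enc_list enc_state
        (fold (add_new bottom) (concat (map (\<lambda>w. map (candidate w) [0..<n]) [w..<n])) gs))
      ((n - w + 1) * ((n + 1) * cost_candidate n + 40))"
proof (induction arbitrary: gs rule: inc_induct)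
  case base
  show ?case
    by (rule call_returnsI[OF _ program_nth(12)]) (use W_props(1) in \<open>auto simp: body_defs\<close>)
next
  case (step w)
  have drop: "drop w W = W ! w # drop (Suc w) W"
    using step.hyps W_props(1) by (simp add: Cons_nth_drop_Suc)
  define gs' where "gs' = fold (add_new bottom) (map (candidate w) [0..<n]) gs"
  have diff: "n - w = Suc (n - Suc w)"
    using step.hyps by simp
  have "length gs + n \<le> n * n"
    using step.prems(2) unfolding diff by simp
  then have row: "call_returns (program_of m) fn_collect_worker
      [enc_list enc_state gs, enc_nat w, enc_list enc_nat (W ! w), enc_state bottom, enc_input A B]
      (enc_list enc_state gs') ((n + 1) * cost_candidate n)"
    using collect_worker_returns[of w bottom 0 gs m] step bottom by (simp add: gs'_def)
  have "length gs' \<le> length gs + n"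
    using length_fold_add_new[of bottom "map (candidate w) [0..<n]" gs] by (simp add: gs'_def)
  then have "length gs' + (n - Suc w) * n \<le> n * n"
    using step.prems(2) unfolding diff by simp
  from step.IH[OF fold_add_new_candidate_feasible[OF step.prems(1)] this[unfolded gs'_def]]
  have IH: "call_returns (program_of m) fn_collect
      [enc_list enc_state gs', Node Leaf (enc_nat w), enc_list (enc_list enc_nat) (drop (Suc w) W),
       enc_state bottom, enc_input A B]
      (enc_list enc_state
        (fold (add_new bottom) (concat (map (\<lambda>w. map (candidate w) [0..<n]) [w..<n])) gs))
      ((n - w) * ((n + 1) * cost_candidate n + 40))"
    using step.hyps by (simp add: Suc_diff_Suc gs'_def upt_conv_Cons)
  show ?case
    unfolding drop
    by (rule call_returnsI[OF _ program_nth(12)])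
      (auto simp: body_defs intro!: wp_callI[OF row] wp_callI[OF IH])
qed

lemma collect_returns:
  assumes "bottom \<in> feasible"
  shows "call_returns (program_of m) fn_collect
      [Leaf, Leaf, enc_state (replicate n 0), enc_state bottom, enc_input A B]
      (enc_list enc_state (generators bottom)) (cost_collect n)"
  using collect_returns_aux[OF assms, of 0 "[]" m]
  by (simp add: generators_def cost_collect_def enc_state_def suffixes_zero)

lemma order_row_returns:
  assumes gs: "set gs \<subseteq> feasible" and i: "i < length gs"
  shows "j \<le> length gs \<Longrightarrow> call_returns (program_of m) fn_order_row
      [enc_nat i, enc_state (gs ! i), enc_list enc_state (drop j gs), enc_nat j, enc_pairs acc]
      (enc_pairs (order_row gs i j @ acc)) ((length gs - j + 1) * (cost_vec_le n + 40))"
proof (induction arbitrary: acc rule: inc_induct)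
  case base
  show ?case
    by (rule call_returnsI[OF _ program_nth(13)]) (auto simp: body_defs order_row_def)
next
  case (step j)
  have drop: "drop j gs = gs ! j # drop (Suc j) gs"
    using step.hyps by (simp add: Cons_nth_drop_Suc)
  have "gs ! i \<in> feasible" "gs ! j \<in> feasible"
    using gs i step.hyps nth_mem by blast+
  note le = vec_le_returns[OF this, of m]
  define acc' where "acc' = (if gs ! i \<sqsubseteq> gs ! j then (i, j) # acc else acc)"
  have row: "order_row gs i j @ acc = order_row gs i (Suc j) @ acc'"
    using step.hyps by (simp add: order_row_def acc'_def upt_conv_Cons)
  have IH: "call_returns (program_of m) fn_order_row
      [enc_nat i, enc_state (gs ! i), enc_list enc_state (drop (Suc j) gs), Node Leaf (enc_nat j),
       enc_pairs acc']
      (enc_pairs (order_row gs i j @ acc)) ((length gs - j) * (cost_vec_le n + 40))"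
    using step.IH[of acc'] step.hyps by (simp add: Suc_diff_Suc row)
  show ?case
  proof (cases "gs ! i \<sqsubseteq> gs ! j")
    case True
    then have "enc_pairs acc' = Node (Node (enc_nat i) (enc_nat j)) (enc_pairs acc)"
      by (simp add: acc'_def enc_pair_def)
    note IH = IH[unfolded this]
    show ?thesis
      unfolding drop using True
      by (intro call_returnsI[OF _ program_nth(13)])
        (auto simp: body_defs intro!: wp_callI[OF le] wp_callI[OF IH])
  next
    case False
    then have "acc' = acc"
      by (simp add: acc'_def)
    note IH = IH[unfolded this]
    show ?thesis
      unfolding drop using False
      by (intro call_returnsI[OF _ program_nth(13)])
        (auto simp: body_defs intro!: wp_callI[OF le] wp_callI[OF IH])
  qed
qed

lemma order_returns_aux:
  assumes gs: "set gs \<subseteq> feasible"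
  shows "i \<le> length gs \<Longrightarrow> call_returns (program_of m) fn_order
      [enc_list enc_state (drop i gs), enc_nat i, enc_list enc_state gs, enc_pairs acc]
      (enc_pairs (order_pairs gs i @ acc))
      ((length gs - i + 1) * ((length gs + 1) * (cost_vec_le n + 40) + 40))"
proof (induction arbitrary: acc rule: inc_induct)
  case base
  show ?case
    by (rule call_returnsI[OF _ program_nth(14)]) (auto simp: body_defs order_pairs_def)
next
  case (step i)
  have drop: "drop i gs = gs ! i # drop (Suc i) gs"
    using step.hyps by (simp add: Cons_nth_drop_Suc)
  have row: "call_returns (program_of m) fn_order_row
      [enc_nat i, enc_state (gs ! i), enc_list enc_state gs, Leaf, enc_pairs acc]
      (enc_pairs (order_row gs i 0 @ acc)) ((length gs + 1) * (cost_vec_le n + 40))"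
    using order_row_returns[OF gs step.hyps(2), of 0 m acc] by simp
  have IH: "call_returns (program_of m) fn_order
      [enc_list enc_state (drop (Suc i) gs), Node Leaf (enc_nat i), enc_list enc_state gs,
       enc_pairs (order_row gs i 0 @ acc)]
      (enc_pairs (order_pairs gs i @ acc))
      ((length gs - i) * ((length gs + 1) * (cost_vec_le n + 40) + 40))"
    using step.IH[of "order_row gs i 0 @ acc"] step.hyps
    by (simp add: Suc_diff_Suc order_pairs_def upt_conv_Cons)
  show ?case
    unfolding drop
    by (rule call_returnsI[OF _ program_nth(14)])
      (auto simp: body_defs intro!: wp_callI[OF row] wp_callI[OF IH])
qed

lemma order_returns:
  assumes "set gs \<subseteq> feasible"
  shows "call_returns (program_of m) fn_order
      [enc_list enc_state gs, Leaf, enc_list enc_state gs, Leaf]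
      (enc_pairs (order_pairs gs 0))
      ((length gs + 1) * ((length gs + 1) * (cost_vec_le n + 40) + 40))"
  using order_returns_aux[OF assms, of 0 m "[]"] by simp

lemma next_from_returns:
  assumes p: "p \<in> feasible"
  shows "w \<le> n \<Longrightarrow> call_returns (program_of m) fn_next [enc_state p, enc_nat w, enc_input A B]
      (enc_option enc_state (next_from p w))
      ((w + 1) * (cost_closure n + 60 * n + 30 * state_size n + 200))"
proof (induction w)
  case 0
  show ?case
    by (rule call_returnsI[OF _ program_nth(16)]) (auto simp: body_defs)
next
  case (Suc w)
  have w: "w < n" and len: "length p = n" and pw: "p ! w < n"
    using Suc.prems p feasibleD by auto
  note IH = wp_callI[OF Suc.IH[OF less_imp_le[OF w]]]
  have nth: "call_returns (program_of m) fn_nth [enc_state q, enc_nat w]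
      (enc_list enc_nat (drop (q ! w) (W ! w))) (10 * n + 10)" for q
    using call_returns_mono[OF nth_returns[of w "suffixes q" m "enc_list enc_nat"], of "10 * n + 10"]
      w by (simp add: enc_state_def suffixes_nth)
  have raised: "take w p @ Suc (p ! w) # drop (Suc w) (replicate n 0) = raised p w"
    by (simp add: raised_def)
  have tl: "tl (drop (p ! w) (W ! w)) = drop (Suc (p ! w)) (W ! w)"
    by (simp add: drop_Suc tl_drop)
  note splice = state_splice_returns[OF len _ w, of "replicate n 0" _ "Suc (p ! w)" m,
      unfolded raised, simplified, OF refl]
  have "raised p w \<in> vectors"
    using w len feasibleD(2)[OF p] by (auto simp: vectors_def raised_def nth_append nth_Cons' Suc_le_eq less_imp_le)
  note clos = closure_returns[OF this, of m]
  show ?case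
  proof (cases "closure (raised p w)")
    case None
    show ?thesis
      using None by (intro call_returnsI[OF _ program_nth(16)])
        (auto simp: body_defs enc_input_simps tl intro!: wp_callI[OF nth] wp_callI[OF splice]
          wp_callI[OF clos] IH)
  next
    case (Some q)
    then have q: "q \<in> feasible"
      by (rule closure_feasible)
    have len_q: "length q = n"
      by (rule feasibleD(1)[OF q])
    let ?q = "take w p @ q ! w # drop (Suc w) q"
    have "?q \<in> vectors"
      using w len len_q feasibleD(2)[OF p] feasibleD(2)[OF q]
      by (auto simp: vectors_def nth_append nth_Cons' less_imp_le)
    then have eq: "call_returns (program_of m) fn_eq [enc_state ?q, enc_state q]
        (enc_bool (?q = q)) (30 * state_size n + 10)"
      by (rule state_eq_returns[OF _ feasible_imp_vector[OF q]])
    have "?q = q \<longleftrightarrow> take w p @ q ! w # drop (Suc w) q = take w q @ q ! w # drop (Suc w) q"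
      using id_take_nth_drop[of w q] w len_q by simp
    then have q_iff: "?q = q \<longleftrightarrow> take w q = take w p"
      using w len len_q by auto
    note splice' = state_splice_returns[OF len len_q w refl, of m "q ! w"]
    show ?thesis
      using Some by (intro call_returnsI[OF _ program_nth(16)])
        (auto simp: body_defs enc_input_simps tl q_iff intro!: wp_callI[OF nth] wp_callI[OF splice]
          wp_callI[OF splice'] wp_callI[OF eq] wp_callI[OF clos] IH)
  qed
qed

lemma next_feasible_returns:
  assumes "p \<in> feasible"
  shows "call_returns (program_of m) fn_next [enc_state p, enc_nat n, enc_input A B]
      (enc_option enc_state (next_feasible p)) (cost_next n)"
  using next_from_returns[OF assms, of n m] by (simp add: next_feasible_def cost_next_def)

end

section \<open>Correctness and running times of the programs\<close>

text \<open>
  Every prefix of the trace without outputs has length at most \<open>l\<close>, and every later part without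
  outputs has length at most \<open>d\<close>.
\<close>

fun paced :: "nat \<Rightarrow> nat \<Rightarrow> event list \<Rightarrow> bool" where
  "paced d l [] \<longleftrightarrow> True"
| "paced d l (Step # t) \<longleftrightarrow> 0 < l \<and> paced d (l - 1) t"
| "paced d l (Out v # t) \<longleftrightarrow> paced d d t"

lemma paced_replicate_append:
  "paced d l (replicate k Step @ t) \<longleftrightarrow> k \<le> l \<and> paced d (l - k) t"
proof (induction k arbitrary: l)
  case (Suc k)
  then show ?case
    by (cases l) auto
qed simp

lemma paced_append_le: "paced d l (xs @ t) \<Longrightarrow> l \<le> d \<Longrightarrow> \<exists>l'\<le>d. paced d l' t"
proof (induction xs arbitrary: l)
  case (Cons x xs)
  then show ?case
    by (cases x) (auto intro: Cons.IH[of "l - 1"] Cons.IH[of d])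
qed auto

lemma eq_replicate_Step: "set t \<subseteq> {Step} \<Longrightarrow> t = replicate (length t) Step"
  by (metis replicate_length_same singletonD subsetD)

lemma paced_imp_delay_at_most:
  assumes "paced d l t" "l \<le> d"
  shows "delay_at_most d t"
  unfolding delay_at_most_def
proof (intro allI impI)
  fix xs ys zs
  assume *: "t = xs @ ys @ zs \<and> set ys \<subseteq> {Step}"
  then obtain l' where "l' \<le> d" "paced d l' (ys @ zs)"
    using paced_append_le assms by blast
  then have "paced d l' (replicate (length ys) Step @ zs)"
    using eq_replicate_Step[of ys] * by simp
  then show "length ys \<le> d"
    using \<open>l' \<le> d\<close> by (simp add: paced_replicate_append)
qed

lemma outputs_replicate_Step_append: "outputs (replicate k Step @ t) = outputs t"
  by (induction k) auto

text \<open>Traces with outputs have to be assembled by the execution rules; this supplies their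
  output-free pieces as explicit blocks of steps.\<close>

lemma wp_execD:
  assumes "wp P env e (\<lambda>v t. v = r \<and> t \<le> T)"
  shows "\<exists>k\<le>T. exec P env e (replicate k Step) r"
proof -
  obtain t where "exec P env e t r" "set t \<subseteq> {Step}" "length t \<le> T"
    using assms by (auto simp: wp_def)
  then show ?thesis
    using eq_replicate_Step[of t] by (intro exI[of _ "length t"]) simp
qed

lemma wps_execD:
  assumes "wps P env es (\<lambda>vs t. vs = rs \<and> t \<le> T)"
  shows "\<exists>k\<le>T. execs P env es (replicate k Step) rs"
proof -
  obtain t where "execs P env es t rs" "set t \<subseteq> {Step}" "length t \<le> T"
    using assms by (auto simp: wps_def)
  then show ?thesis
    using eq_replicate_Step[of t] by (intro exI[of _ "length t"]) simp
qed

lemma exec_body_enumerate_Leaf: "exec P (Leaf # env) body_enumerate (replicate 3 Step) Leaf"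
proof -
  have "exec P (Leaf # env) (EVar 0) [Step] Leaf"
    using ex_Var[of 0 "Leaf # env" P] by simp
  from ex_If_false[OF this refl ex_Leaf] show ?thesis
    by (simp add: body_enumerate_def numeral_3_eq_3)
qed

text \<open>The summand \<open>n * (n + 1)\<close> bounds the size of an encoded matching, for which
  \<open>EEmit\<close> charges.\<close>

definition cost_heads :: "nat \<Rightarrow> nat" where
  "cost_heads n = 20 * n + 30 + n * (n + 1)"

text \<open>One sum covers every gap: a closure and a head extraction before the first output, a
  successor search and a head extraction between outputs, a search alone at the end, and a closure
  alone if nothing is feasible.\<close>

definition delay_bound :: "nat \<Rightarrow> nat" where
  "delay_bound n = cost_heads n + cost_next n + cost_closure n + 20 * n + 60"

section \<open>The enumeration program\<close>

context common_instances
begin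

text \<open>Here \<open>l\<close> is what remains of the delay when the call begins. Emitting
  \<open>p\<close> is the first thing that happens, so \<open>cost_heads n\<close> suffices, and the
  output renews the budget for the successor search and the next call.\<close>

lemma enumerate_exec:
  assumes "p \<in> feasible" "cost_heads n \<le> l"
  shows "\<exists>t v ps. exec (program_of m) [enc_option enc_state (Some p), enc_input A B]
      body_enumerate t v \<and>
    paced (delay_bound n) l t \<and> distinct ps \<and> set ps = {q \<in> feasible. q = p \<or> p \<prec> q} \<and>
    outputs t = map (\<lambda>p. enc_matching n (matching_at p)) ps"
  using assms
proof (induction "card {q \<in> feasible. p \<prec> q}" arbitrary: p l rule: less_induct)
  case less
  let ?P = "program_of m" and ?x = "enc_input A B" and ?d = "delay_bound n"
  let ?env = "[enc_option enc_state (Some p), ?x]"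
  let ?out = "enc_matching n (matching_at p)"
  have "[] \<notin> set (suffixes p)"
    using Nil_in_suffixes_iff[OF feasible_imp_vector[OF less.prems(1)]] feasibleD(2)[OF less.prems(1)]
    by auto
  moreover have "map hd (suffixes p) = map (firm_of (matching_at p)) [0..<n]"
    using W_props(2) feasibleD(2)[OF less.prems(1)]
    by (auto simp: suffixes_def hd_drop_conv_nth firm_of_matching_at assigned_def)
  ultimately have heads: "call_returns ?P fn_heads [enc_state p] ?out (20 * n + 20)"
    using heads_returns[of "suffixes p" m enc_nat] by (simp add: enc_state_def enc_matching_def)
  have "size ?out \<le> n * (n + 1)"
    using size_enc_list_le[of "map (firm_of (matching_at p)) [0..<n]" enc_nat n]
      feasibleD(4)[OF less.prems(1)]
    by (force simp: enc_matching_def firm_of_matching_at)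
  have "\<exists>k\<le>20 * n + 25. exec ?P ?env (ECall fn_heads [ESnd (EVar 0)]) (replicate k Step) ?out"
    by (rule wp_execD) (auto intro!: wp_callI[OF heads])
  then obtain k1 where k1: "k1 \<le> 20 * n + 25"
    "exec ?P ?env (ECall fn_heads [ESnd (EVar 0)]) (replicate k1 Step) ?out"
    by blast
  \<comment> \<open>Two steps for the test of the conditional, \<open>k1\<close> for computing the
    matching, and the charge of \<open>EEmit\<close>. The \<open>k3 + 2\<close> steps after the
    output add the let and the recursive call to the evaluation of the arguments.\<close>
  define k2 where "k2 = 2 + k1 + (size ?out + 1)"
  have k2: "k2 \<le> cost_heads n"
    using k1(1) \<open>size ?out \<le> n * (n + 1)\<close> by (simp add: k2_def cost_heads_def)
  have len: "call_returns ?P fn_length [enc_state p] (enc_nat n) (20 * n + 20)"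
    using length_returns[of m "enc_list enc_nat" "suffixes p"] by (simp add: enc_state_def)
  let ?args = "[ECall fn_next [ESnd (EVar 1), ECall fn_length [ESnd (EVar 1)], EVar 2], EVar 2]"
  let ?next = "enc_option enc_state (next_feasible p)"
  have "\<exists>k\<le>cost_next n + 20 * n + 40. execs ?P (?out # ?env) ?args (replicate k Step) [?next, ?x]"
    by (rule wps_execD)
      (auto intro!: wp_callI[OF len] wp_callI[OF next_feasible_returns[OF less.prems(1)]])
  then obtain k3 where k3: "k3 \<le> cost_next n + 20 * n + 40"
    "execs ?P (?out # ?env) ?args (replicate k3 Step) [?next, ?x]"
    by blast
  have exec: "exec ?P ?env body_enumerate
      (replicate k2 Step @ Out ?out # replicate (k3 + 2) Step @ t) v"
    if "exec ?P [?next, ?x] body_enumerate t v" for t v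
  proof -
    have "exec ?P (?out # ?env) (ECall fn_enumerate ?args) (replicate k3 Step @ [Step] @ t) v"
      using that by (intro ex_Call[OF k3(2)]) (simp, simp only: program_nth)
    from ex_Let[OF ex_Emit[OF k1(2)] this]
    have "exec ?P ?env (ELet (EEmit (ECall fn_heads [ESnd (EVar 0)])) (ECall fn_enumerate ?args))
      ((replicate k1 Step @ replicate (size ?out + 1) Step @ [Out ?out]) @ [Step] @
        replicate k3 Step @ [Step] @ t) v" .
    from ex_If_true[OF ex_Var _ this, of 0 ELeaf]
    show ?thesis
      by (simp add: body_enumerate_def Let_def k2_def numeral_2_eq_2 replicate_add
        replicate_app_Cons_same)
  qed
  have paced: "paced ?d l (replicate k2 Step @ Out ?out # replicate (k3 + 2) Step @ t)"
    if "paced ?d (?d - (k3 + 2)) t" for t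
    using that k2 k3(1) less.prems(2) by (simp add: paced_replicate_append delay_bound_def)
  have outputs: "outputs (replicate k2 Step @ Out ?out # replicate (k3 + 2) Step @ t) = ?out # outputs t"
    for t
    by (simp add: outputs_replicate_Step_append del: replicate_Suc)
  have irrefl: "\<not> r \<prec> r" for r
    using lexord_irreflexive[of "{(x, y). x < y}" r] by auto
  show ?case
  proof (cases "next_feasible p")
    case None
    have "exec ?P [?next, ?x] body_enumerate (replicate 3 Step) Leaf"
      using None exec_body_enumerate_Leaf by simp
    note exec = exec[OF this]
    have "paced ?d (?d - (k3 + 2)) (replicate 3 Step)"
      using k3(1) by (simp add: delay_bound_def numeral_3_eq_3)
    note paced = paced[OF this]
    have "set [p] = {q \<in> feasible. q = p \<or> p \<prec> q}"
      using next_feasible_None[OF less.prems(1) None] less.prems(1) by auto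
    moreover have "outputs (replicate k2 Step @ Out ?out # replicate (k3 + 2) Step @ replicate 3 Step)
        = map (\<lambda>p. enc_matching n (matching_at p)) [p]"
      unfolding outputs by (simp add: numeral_3_eq_3)
    moreover have "distinct [p]"
      by simp
    ultimately show ?thesis
      using exec paced by blast
  next
    case (Some q)
    note q = next_feasible_Some[OF less.prems(1) Some]
    have "q \<notin> {r \<in> feasible. q \<prec> r}"
      using irrefl by blast
    then have "card {r \<in> feasible. q \<prec> r} < card {r \<in> feasible. p \<prec> r}"
      unfolding q(3) using finite_feasible by simp
    moreover have "cost_heads n \<le> ?d - (k3 + 2)"
      using k3(1) by (simp add: delay_bound_def)
    ultimately obtain t v ps where IH: "exec ?P [?next, ?x] body_enumerate t v"
      "paced ?d (?d - (k3 + 2)) t" "distinct ps" "set ps = {r \<in> feasible. r = q \<or> q \<prec> r}"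
      "outputs t = map (\<lambda>p. enc_matching n (matching_at p)) ps"
      using less.hyps[OF _ q(1)] unfolding Some by blast
    have later: "set ps = {r \<in> feasible. p \<prec> r}"
      using IH(4) q by auto
    then have "distinct (p # ps)" "set (p # ps) = {r \<in> feasible. r = p \<or> p \<prec> r}"
      using IH(3) irrefl less.prems(1) by auto
    moreover have "outputs (replicate k2 Step @ Out ?out # replicate (k3 + 2) Step @ t)
        = map (\<lambda>p. enc_matching n (matching_at p)) (p # ps)"
      using outputs IH(5) by simp
    ultimately show ?thesis
      using exec[OF IH(1)] paced[OF IH(2)] by blast
  qed
qed

lemma enumeration_run:
  "\<exists>t v Ms. run (program_of main_enumerate) (enc_input A B) t v \<and>
    delay_at_most (delay_bound n) t \<and>
    distinct Ms \<and> set Ms = stable_matchings n A \<inter> stable_matchings n B \<and>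
    outputs t = map (enc_matching n) Ms"
proof -
  let ?P = "program_of main_enumerate" and ?x = "enc_input A B"
  let ?args = "[ECall fn_closure [EWorkers (EVar 0), EVar 0], EVar 0]"
  let ?start = "enc_option enc_state (closure (replicate n 0))"
  have "\<exists>k\<le>cost_closure n + 20. execs ?P [?x] ?args (replicate k Step) [?start, ?x]"
    by (rule wps_execD) (auto simp: enc_input_simps intro!: wp_callI[OF closure_returns[OF zero_vector]])
  then obtain k where k: "k \<le> cost_closure n + 20" "execs ?P [?x] ?args (replicate k Step) [?start, ?x]"
    by blast
  \<comment> \<open>The three extra steps are the argument of the main call, the main call itself
    and the call of the enumeration function.\<close>
  have run: "run ?P ?x (replicate (k + 3) Step @ t) v"
    if "exec ?P [?start, ?x] body_enumerate t v" for t v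
  proof -
    have "exec ?P [?x] (ECall fn_enumerate ?args) (replicate k Step @ [Step] @ t) v"
      using that by (intro ex_Call[OF k(2)]) (simp, simp only: program_nth)
    then have "exec ?P [?x] (?P ! 0) (replicate k Step @ [Step] @ t) v"
      by (simp add: main_enumerate_def)
    then have "exec ?P [?x] (ECall 0 [EVar 0])
        (([Step] @ []) @ [Step] @ replicate k Step @ [Step] @ t) v"
      using ex_Var[of 0 "[?x]" ?P] by (intro ex_Call[OF exs_Cons[OF _ exs_Nil]]) auto
    then show ?thesis
      by (simp add: run_def numeral_3_eq_3 replicate_app_Cons_same)
  qed
  show ?thesis
  proof (cases "closure (replicate n 0)")
    case None
    have "exec ?P [?start, ?x] body_enumerate (replicate 3 Step) Leaf"
      using None exec_body_enumerate_Leaf by simp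
    from run[OF this] have "run ?P ?x (replicate (k + 6) Step @ []) Leaf"
      by (simp add: numeral_eq_Suc replicate_app_Cons_same)
    moreover have "stable_matchings n A \<inter> stable_matchings n B = {}"
    proof -
      have "\<forall>q\<in>feasible. replicate n 0 \<sqsubseteq> q"
        using feasibleD(1) by (auto simp: list_all2_conv_all_nth)
      then have "feasible = {}"
        using None unfolding closure_eq_None_iff by blast
      then show ?thesis
        using matching_at_bij by (simp add: bij_betw_def)
    qed
    moreover have "delay_at_most (delay_bound n) (replicate (k + 6) Step @ [])"
      by (rule paced_imp_delay_at_most[OF _ le_refl])
        (use k(1) in \<open>simp only: paced_replicate_append, simp add: delay_bound_def\<close>)
    moreover have "outputs (replicate (k + 6) Step @ []) = map (enc_matching n) []"
      by (simp only: outputs_replicate_Step_append) simp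
    ultimately show ?thesis
      by (metis distinct.simps(1) empty_set)
  next
    case (Some p)
    have "cost_heads n \<le> delay_bound n - (k + 3)"
      using k(1) by (simp add: delay_bound_def)
    from enumerate_exec[OF closure_feasible[OF Some] this, of main_enumerate]
    obtain t v ps where t: "exec ?P [?start, ?x] body_enumerate t v"
      "paced (delay_bound n) (delay_bound n - (k + 3)) t" "distinct ps"
      "set ps = {q \<in> feasible. q = p \<or> p \<prec> q}"
      "outputs t = map (\<lambda>p. enc_matching n (matching_at p)) ps"
      unfolding Some by blast
    \<comment> \<open>The bottom is also lexicographically first, so an enumeration started there
      reaches every feasible vector.\<close>
    have "p \<sqsubseteq> q" if "q \<in> feasible" for q
      using closure_SomeD(3)[OF Some that] feasibleD(1)[OF that] by (simp add: list_all2_conv_all_nth)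
    then have ps: "set ps = feasible"
      using t(4) vec_le_imp_lexord by blast
    have "paced (delay_bound n) (delay_bound n) (replicate (k + 3) Step @ t)"
      unfolding paced_replicate_append using t(2) k(1) by (simp add: delay_bound_def)
    then have "delay_at_most (delay_bound n) (replicate (k + 3) Step @ t)"
      by (rule paced_imp_delay_at_most) simp
    moreover have "distinct (map matching_at ps)"
      using t(3) matching_at_inj ps by (simp add: distinct_map)
    moreover have "set (map matching_at ps) = stable_matchings n A \<inter> stable_matchings n B"
      using matching_at_bij ps by (simp add: bij_betw_def)
    moreover have "outputs (replicate (k + 3) Step @ t) = map (enc_matching n) (map matching_at ps)"
      using t(5) by (simp only: outputs_replicate_Step_append) simp
    ultimately show ?thesis
      using run[OF t(1)] by blast
  qed
qed

end

section \<open>The program computing the Birkhoff order\<close>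

definition cost_order :: "nat \<Rightarrow> nat" where
  "cost_order n = (n * n + 1) * ((n * n + 1) * (cost_vec_le n + 40) + 40)"

text \<open>The second line and the last unit of \<open>201\<close> pay for the size of the answer:
  a unary number up to \<open>n * n\<close>, at most \<open>n * n * (n * n)\<close> pairs of such
  numbers with their list cells, and the root.\<close>

definition time_bound :: "nat \<Rightarrow> nat" where
  "time_bound n = cost_closure n + cost_collect n + cost_order n + 20 * (n * n) + 201
     + n * n + n * n * (n * n) * (2 * (n * n) + 2)"

lemma birkhoff_run:
  assumes "sm_instance n A" "sm_instance n B" "worker_prefs A = worker_prefs B"
  shows "\<exists>t v. run (program_of main_order) (enc_input A B) t v \<and> run_time t v \<le> time_bound n \<and>
    birkhoff_answer n A (stable_matchings n A \<inter> stable_matchings n B) v"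
proof -
  interpret common_instances n A B
    by standard fact+
  let ?P = "program_of main_order" and ?x = "enc_input A B"
  let ?S = "stable_matchings n A \<inter> stable_matchings n B"
  note clos = wp_callI[OF closure_returns[OF zero_vector, of main_order]]
  \<comment> \<open>The \<open>2\<close> accounts for evaluating the argument of the main function
    and for calling it.\<close>
  have run: "\<exists>t. run ?P ?x t r \<and> length t \<le> T"
    if "main_order = e" "wp ?P [?x] e (\<lambda>v t. v = r \<and> t + 2 \<le> T)" for e r T
  proof -
    have "wp_call ?P 0 [?x] (\<lambda>v t. v = r \<and> t + 2 \<le> T)"
      using that by (simp add: wp_call_def)
    then have "wp ?P [?x] (ECall 0 [EVar 0]) (\<lambda>v t. v = r \<and> t \<le> T)"
      by simp
    then show ?thesis
      by (auto simp: run_def wp_def simp del: wp_simps)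
  qed
  show ?thesis
  proof (cases "closure (replicate n 0)")
    case None
    have "feasible = {}"
      using None feasibleD(1) unfolding closure_eq_None_iff list_all2_conv_all_nth by auto
    then have "?S = {}"
      using matching_at_bij by (simp add: bij_betw_def)
    moreover have "\<exists>t. run ?P ?x t Leaf \<and> length t \<le> time_bound n"
      using None by (intro run[OF main_order_def]) (auto simp: enc_input_simps time_bound_def intro!: clos)
    ultimately show ?thesis
      by (auto simp: birkhoff_answer_def run_time_def)
  next
    case (Some bottom)
    have bottom: "bottom \<in> feasible"
      by (rule closure_feasible[OF Some])
    let ?gs = "generators bottom"
    let ?m = "length ?gs" and ?rs = "order_pairs ?gs 0"
    let ?T = "cost_closure n + cost_collect n + cost_order n + 20 * (n * n) + 200"
    have "call_returns ?P fn_order [enc_list enc_state ?gs, Leaf, enc_list enc_state ?gs, Leaf]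
        (enc_pairs ?rs) (cost_order n)"
      using length_generators[of bottom]
      by (intro call_returns_mono[OF order_returns[OF generators_feasible]])
        (auto simp: cost_order_def intro!: mult_mono add_mono simp del: mult_Suc)
    note order = wp_callI[OF this]
    have "call_returns ?P fn_length [enc_list enc_state ?gs] (enc_nat ?m) (20 * (n * n) + 20)"
      using length_generators[of bottom] by (intro call_returns_mono[OF length_returns]) auto
    note len = wp_callI[OF this]
    have "\<exists>t. run ?P ?x t (enc_poset ?m ?rs) \<and> length t \<le> ?T"
      using Some by (intro run[OF main_order_def])
        (auto simp: enc_input_simps enc_poset_def intro!: clos
          wp_callI[OF collect_returns[OF bottom]] len order)
    then obtain t where t: "run ?P ?x t (enc_poset ?m ?rs)" "length t \<le> ?T"
      by blast
    have "size (enc_pair enc_nat enc_nat r) \<le> 2 * (n * n) + 1" if "r \<in> set ?rs" for r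
      using that length_generators[of bottom] by (auto simp: set_order_pairs enc_pair_def)
    then have "size (enc_pairs ?rs) \<le> length ?rs * (2 * (n * n) + 1 + 1)"
      by (rule size_enc_list_le)
    also have "\<dots> \<le> n * n * (n * n) * (2 * (n * n) + 1 + 1)"
      using length_order_pairs[of ?gs] mult_mono[OF length_generators[of bottom] length_generators[of bottom]]
      by (intro mult_right_mono) auto
    finally have "run_time t (enc_poset ?m ?rs) \<le> time_bound n"
      using t(2) length_generators[of bottom]
      by (simp add: run_time_def enc_poset_def time_bound_def)
    moreover have "?S \<noteq> {}"
      using matching_at_bij bottom by (auto simp: bij_betw_def)
    ultimately show ?thesis
      using t(1) birkhoff_order_generators[OF Some] by (auto simp: birkhoff_answer_def)
  qed
qed

section \<open>Polynomiality of the bounds\<close>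

definition is_poly :: "(nat \<Rightarrow> nat) \<Rightarrow> bool" where
  "is_poly T \<longleftrightarrow> (\<exists>q. \<forall>n. T n = poly q n)"

lemma is_poly_intros:
  "is_poly (\<lambda>n. c)"
  "is_poly (\<lambda>n. n)"
  "is_poly S \<Longrightarrow> is_poly T \<Longrightarrow> is_poly (\<lambda>n. S n + T n)"
  "is_poly S \<Longrightarrow> is_poly T \<Longrightarrow> is_poly (\<lambda>n. S n * T n)"
proof -
  show "is_poly (\<lambda>n. c)"
    unfolding is_poly_def by (rule exI[of _ "[:c:]"]) simp
  show "is_poly (\<lambda>n. n)"
    unfolding is_poly_def by (rule exI[of _ "[:0, 1:]"]) simp
  assume "is_poly S" "is_poly T"
  then obtain p q where "\<forall>n. S n = poly p n" "\<forall>n. T n = poly q n"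
    by (auto simp: is_poly_def)
  then show "is_poly (\<lambda>n. S n + T n)" "is_poly (\<lambda>n. S n * T n)"
    unfolding is_poly_def by (metis poly_add, metis poly_mult)
qed

lemmas cost_defs = cost_mem_def cost_precedes_def cost_forbidden_def cost_advance_def
  state_size_def cost_round_def cost_closure_def cost_vec_le_def cost_candidate_def
  cost_collect_def cost_next_def cost_heads_def cost_order_def

lemma is_poly_time_bound: "is_poly time_bound"
  unfolding time_bound_def[abs_def] cost_defs by (intro is_poly_intros)

lemma is_poly_delay_bound: "is_poly delay_bound"
  unfolding delay_bound_def[abs_def] cost_defs by (intro is_poly_intros)

theorem theorem8:
  shows "(\<exists>(P :: program) (q :: nat poly). \<forall>(n :: nat) (A :: sm_instance) (B :: sm_instance).
            sm_instance n A \<and> sm_instance n B \<and> worker_prefs A = worker_prefs B \<longrightarrow>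
            (\<exists>t v. run P (enc_input A B) t v \<and>
                   run_time t v \<le> poly q n \<and>
                   birkhoff_answer n A (stable_matchings n A \<inter> stable_matchings n B) v))
       \<and> (\<exists>(P :: program) (q :: nat poly). \<forall>(n :: nat) (A :: sm_instance) (B :: sm_instance).
            sm_instance n A \<and> sm_instance n B \<and> worker_prefs A = worker_prefs B \<longrightarrow>
            (\<exists>t v Ms. run P (enc_input A B) t v \<and>
                      delay_at_most (poly q n) t \<and>
                      distinct Ms \<and> set Ms = stable_matchings n A \<inter> stable_matchings n B \<and>
                      outputs t = map (enc_matching n) Ms))"
proof -
  obtain q1 q2 where q: "\<And>n. time_bound n = poly q1 n" "\<And>n. delay_bound n = poly q2 n"
    using is_poly_time_bound is_poly_delay_bound by (auto simp: is_poly_def)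
  have enum: "\<exists>t v Ms. run (program_of main_enumerate) (enc_input A B) t v \<and>
      delay_at_most (poly q2 n) t \<and> distinct Ms \<and>
      set Ms = stable_matchings n A \<inter> stable_matchings n B \<and> outputs t = map (enc_matching n) Ms"
    if "sm_instance n A" "sm_instance n B" "worker_prefs A = worker_prefs B" for n A B
    using common_instances.enumeration_run[OF common_instances.intro, OF that] by (simp add: q)
  show ?thesis
    by (intro conjI exI[of _ "program_of main_order"] exI[of _ q1]
        exI[of _ "program_of main_enumerate"] exI[of _ q2] allI impI)
      (use birkhoff_run enum in \<open>auto simp: q(1)[symmetric]\<close>)
qed

end
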